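(* Let $n$ be a positive integer with $n\in 4\mathbb{Z}$, let $\Omega=\{1,\ldots,n\}$, and let $\mathcal{C}\subseteq\mathcal{E}(\Omega)$ be a binary linear code such that $\Omega\in\mathcal{C}$ and such that for any distinct $i,j\in\Omega$ there is some $T_{ij}\in\mathcal{C}$ with $i\in T_{ij}$ and $j\notin T_{ij}$. Suppose $H=(h_1,\ldots,h_n)\in\{0,\frac12\}^n$ is such that $h_i=\frac12$ for an even number of $i$. Let $v_H=v_{h_1}\otimes\cdots\otimes v_{h_n}$, where $v_{h_i}$ spans the lowest conformal weight space of $L(\frac12,h_i)$. Then the $L(\frac12,0)^{\otimes n}_{\mathcal{C}}$-module $W_{H,\mathcal{C}}$ generated by $v_H$ is an integral form of the $L(\frac12,0)^{\otimes n}$-module $W_H=L(\frac12,h_1)\otimes\cdots\otimes L(\frac12,h_n)$.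
   Context: Vertex operator algebras and modules are over $\mathbb{C}$, with the usual definitions. Write $Y(u,x)=\sum_{m\in\mathbb{Z}}u_m x^{-m-1}$. A vertex subring of $V$ is an additive subgroup containing $\mathbf 1$ and closed under all products $(u,v)\mapsto u_mv$, $m\in\mathbb{Z}$. An integral form of a vertex operator algebra $V$ is a vertex subring $V_\mathbb{Z}$ which is the $\mathbb{Z}$-span of a $\mathbb{C}$-basis of $V$ and is compatible with the conformal weight grading ($V_\mathbb{Z}=\coprod_m V_{(m)}\cap V_\mathbb{Z}$). An integral form of a $V$-module $W$ (with respect to $V_\mathbb{Z}$) is an additive subgroup $W_\mathbb{Z}\subseteq W$ closed under all $u_m$, $u\in V_\mathbb{Z}$, $m\in\mathbb{Z}$, which is the $\mathbb{Z}$-span of a $\mathbb{C}$-basis of $W$ and satisfies $W_\mathbb{Z}=\coprod_{h\in\mathbb{C}}W_{(h)}\cap W_\mathbb{Z}$, where $W_{(h)}$ is the $L(0)$-eigenspace of eigenvalue $h$. The $V_\mathbb{Z}$-module generated by a vector is the smallest additive subgroup containing it and closed under all $u_m$, $u\in V_\mathbb{Z}$. $L(\ell,h)$ is the irreducible lowest weight module for the Virasoro algebra of central charge $\ell$ and lowest conformal weight $h$. $L(\frac12,0)$ is the simple Virasoro vertex operator algebra of central charge $\frac12$, with irreducible modules $L(\frac12,h)$, $h\in\{0,\frac12,\frac1{16}\}$. $L(\frac12,0)^{\otimes n}$ is the usual tensor product vertex operator algebra. For a finite set $\Omega$, $P(\Omega)$ is an $\mathbb{F}_2$-vector space under symmetric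 difference; a binary linear code is an $\mathbb{F}_2$-subspace of $P(\Omega)$; $\mathcal{E}(\Omega)$ is the code of even-cardinality subsets. For $1\le i\le n$, $\omega^{(i)}\in L(\frac12,0)^{\otimes n}$ has the conformal vector of $L(\frac12,0)$ in the $i$-th tensor factor and $\mathbf 1$ elsewhere. For $T\subseteq\Omega=\{1,\ldots,n\}$, $\omega_T=\sum_{i\notin T}\omega^{(i)}-\sum_{i\in T}\omega^{(i)}$. $L(\frac12,0)^{\otimes n}_{\mathcal{C}}$ denotes the vertex subring of $L(\frac12,0)^{\otimes n}$ generated by all $\omega_T$, $T\in\mathcal{C}$; under the stated conditions on $n$ and $\mathcal{C}$ it is an integral form of $L(\frac12,0)^{\otimes n}$. *)

theory Defs
  imports Complex_Main "HOL-Library.Groups_Big_Fun" "HOL-Library.FuncSet"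
begin

section \<open>Vertex operator algebras and modules\<close>

text \<open>
  A complex vector space is a type of class \<^class>\<open>ab_group_add\<close> together with a scalar
  multiplication satisfying \<^locale>\<open>vector_space\<close>.  A vertex operator map
  \<open>Y(u,x) = \<Sum>\<^sub>m u\<^sub>m x\<^bsup>-m-1\<^esup>\<close> is given by its components: \<open>Y u m v\<close> is \<open>u\<^sub>m v\<close>.
\<close>

abbreviation vir_mode :: "('v \<Rightarrow> int \<Rightarrow> 'w \<Rightarrow> 'w) \<Rightarrow> 'v \<Rightarrow> int \<Rightarrow> 'w \<Rightarrow> 'w" where
  "vir_mode Y omega n \<equiv> Y omega (n + 1)"

definition weight_space ::
    "(complex \<Rightarrow> 'w \<Rightarrow> 'w) \<Rightarrow> (int \<Rightarrow> 'w \<Rightarrow> 'w) \<Rightarrow> complex \<Rightarrow> 'w set" where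
  "weight_space s L h = {w. L 0 w = s h w}"

definition virasoro_rep ::
    "(complex \<Rightarrow> 'w::ab_group_add \<Rightarrow> 'w) \<Rightarrow> complex \<Rightarrow> (int \<Rightarrow> 'w \<Rightarrow> 'w) \<Rightarrow> bool" where
  "virasoro_rep s c L \<longleftrightarrow>
     vector_space s \<and> (\<forall>n. Vector_Spaces.linear s s (L n)) \<and>
     (\<forall>m n w. L m (L n w) - L n (L m w) =
        s (of_int (m - n)) (L (m + n) w) +
        (if m + n = 0 then s (of_int (m ^ 3 - m) / 12 * c) w else 0))"

text \<open>
  The Jacobi identity, written out by components: this is the coefficient of
  \<open>x\<^sub>0\<^bsup>-l-1\<^esup> x\<^sub>1\<^bsup>-m-1\<^esup> x\<^sub>2\<^bsup>-n-1\<^esup>\<close> in the formal delta function form, applied to \<open>w\<close>.  By lower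
  truncation each of the three sums has only finitely many nonzero terms, so that
  \<^const>\<open>Sum_any\<close> (sum over all arguments with nonzero value) is the intended sum.
\<close>

definition jacobi_identity ::
    "(complex \<Rightarrow> 'w::ab_group_add \<Rightarrow> 'w) \<Rightarrow> ('v \<Rightarrow> int \<Rightarrow> 'v \<Rightarrow> 'v) \<Rightarrow> ('v \<Rightarrow> int \<Rightarrow> 'w \<Rightarrow> 'w) \<Rightarrow> bool"
  where
  "jacobi_identity s Y YW \<longleftrightarrow> (\<forall>u v w l m n.
     Sum_any (\<lambda>i::nat. s ((-1) ^ i * (of_int l gchoose i)) (YW u (m + l - int i) (YW v (n + int i) w)))
     - s ((-1) powi l)
        (Sum_any (\<lambda>i::nat. s ((-1) ^ i * (of_int l gchoose i)) (YW v (n + l - int i) (YW u (m + int i) w))))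
     = Sum_any (\<lambda>i::nat. s (of_int m gchoose i) (YW (Y u (l + int i) v) (m + n - int i) w)))"

text \<open>The axioms that a vertex operator algebra and its modules have in common.\<close>

locale vertex_action =
  fixes sV :: "complex \<Rightarrow> 'v::ab_group_add \<Rightarrow> 'v"
    and Y :: "'v \<Rightarrow> int \<Rightarrow> 'v \<Rightarrow> 'v" and one omega :: 'v and c :: complex
    and sW :: "complex \<Rightarrow> 'w::ab_group_add \<Rightarrow> 'w"
    and YW :: "'v \<Rightarrow> int \<Rightarrow> 'w \<Rightarrow> 'w"
  assumes linear_left: "\<And>m w. Vector_Spaces.linear sV sW (\<lambda>u. YW u m w)"
    and linear_right: "\<And>u m. Vector_Spaces.linear sW sW (YW u m)"
    and lower_truncation: "\<And>u w. \<exists>N. \<forall>m\<ge>N. YW u m w = 0"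
    and vacuum: "\<And>m w. YW one m w = (if m = -1 then w else 0)"
    and jacobi: "jacobi_identity sW Y YW"
    and virasoro: "virasoro_rep sW c (vir_mode YW omega)"
    and L_minus_1_derivative:
      "\<And>u m w. YW (vir_mode Y omega (-1) u) m w = sW (- of_int m) (YW u (m - 1) w)"
    and finite_dimensional_weight_spaces:
      "\<And>h. \<exists>B. finite B \<and> weight_space sW (vir_mode YW omega) h = module.span sW B"

text \<open>
  Weight spaces are \<open>L(0)\<close>-eigenspaces, so their sum is automatically direct.
\<close>

locale voa = vertex_action s Y one omega c s Y
  for s :: "complex \<Rightarrow> 'v::ab_group_add \<Rightarrow> 'v" and Y one omega c +
  assumes creation: "\<And>v. Y v (-1) one = v" "\<And>v m. m \<ge> 0 \<Longrightarrow> Y v m one = 0"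
    and grading: "module.span s (\<Union>n::int. weight_space s (vir_mode Y omega) (of_int n)) = UNIV"
    and grading_bounded_below:
      "\<exists>N::int. \<forall>n<N. weight_space s (vir_mode Y omega) (of_int n) = {0}"

locale voa_module = voa sV Y one omega c + vertex_action sV Y one omega c sW YW
  for sV :: "complex \<Rightarrow> 'v::ab_group_add \<Rightarrow> 'v" and Y one omega c
    and sW :: "complex \<Rightarrow> 'w::ab_group_add \<Rightarrow> 'w" and YW +
  assumes module_grading: "module.span sW (\<Union>h. weight_space sW (vir_mode YW omega) h) = UNIV"
    and module_grading_bounded_below:
      "\<And>h. \<exists>N::int. \<forall>n<N. weight_space sW (vir_mode YW omega) (h + of_int n) = {0}"

section \<open>The Virasoro modules \<open>L(\<ell>,h)\<close>\<close>

text \<open>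
  \<open>L(\<ell>,h)\<close> is determined up to isomorphism; the following says that the given representation is
  (a copy of) \<open>L(\<ell>,h)\<close>.
\<close>

definition lowest_weight_vector ::
    "(complex \<Rightarrow> 'w::ab_group_add \<Rightarrow> 'w) \<Rightarrow> (int \<Rightarrow> 'w \<Rightarrow> 'w) \<Rightarrow> complex \<Rightarrow> 'w \<Rightarrow> bool" where
  "lowest_weight_vector s L h w \<longleftrightarrow> w \<noteq> 0 \<and> L 0 w = s h w \<and> (\<forall>n>0. L n w = 0)"

definition virasoro_subrep ::
    "(complex \<Rightarrow> 'w::ab_group_add \<Rightarrow> 'w) \<Rightarrow> (int \<Rightarrow> 'w \<Rightarrow> 'w) \<Rightarrow> 'w set \<Rightarrow> bool" where
  "virasoro_subrep s L U \<longleftrightarrow> module.subspace s U \<and> (\<forall>n. \<forall>w\<in>U. L n w \<in> U)"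

definition irreducible_virasoro_lowest_weight ::
    "(complex \<Rightarrow> 'w::ab_group_add \<Rightarrow> 'w) \<Rightarrow> (int \<Rightarrow> 'w \<Rightarrow> 'w) \<Rightarrow> complex \<Rightarrow> complex \<Rightarrow> bool" where
  "irreducible_virasoro_lowest_weight s L c h \<longleftrightarrow>
     virasoro_rep s c L \<and>
     (\<exists>w. lowest_weight_vector s L h w \<and> virasoro_subrep s L hull {w} = UNIV) \<and>
     (\<forall>U. virasoro_subrep s L U \<longrightarrow> U = {0} \<or> U = UNIV)"

text \<open>The simple Virasoro vertex operator algebra \<open>L(\<ell>,0)\<close> and its modules \<open>L(\<ell>,h)\<close>.\<close>

definition simple_virasoro_voa where
  "simple_virasoro_voa s Y one omega c \<longleftrightarrow>
     voa s Y one omega c \<and> irreducible_virasoro_lowest_weight s (vir_mode Y omega) c 0"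

definition virasoro_voa_module where
  "virasoro_voa_module sV Y one omega c sW YW h \<longleftrightarrow>
     voa_module sV Y one omega c sW YW \<and>
     irreducible_virasoro_lowest_weight sW (vir_mode YW omega) c h"

section \<open>Tensor products\<close>

text \<open>
  A family \<open>(w\<^sub>i)\<^sub>i\<^sub>\<in>\<^sub>I\<close> is a total function of which only the values on \<open>I\<close> matter.
\<close>

definition multilinear ::
    "'i set \<Rightarrow> ('i \<Rightarrow> complex \<Rightarrow> 'w::ab_group_add \<Rightarrow> 'w) \<Rightarrow> (complex \<Rightarrow> 'x::ab_group_add \<Rightarrow> 'x)
     \<Rightarrow> (('i \<Rightarrow> 'w) \<Rightarrow> 'x) \<Rightarrow> bool" where
  "multilinear I s sX f \<longleftrightarrow>
     (\<forall>w w'. (\<forall>i\<in>I. w i = w' i) \<longrightarrow> f w = f w') \<and>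
     (\<forall>i\<in>I. \<forall>w. Vector_Spaces.linear (s i) sX (\<lambda>x. f (w(i := x))))"

text \<open>
  The universal property of the tensor product.  As a definition cannot quantify over the type of the
  target space, it is stated for scalar-valued multilinear maps; the lemma
  \<open>tensor_product_universal\<close> below gives it for arbitrary targets.
\<close>

definition tensor_product ::
    "'i set \<Rightarrow> ('i \<Rightarrow> complex \<Rightarrow> 'w::ab_group_add \<Rightarrow> 'w) \<Rightarrow> (complex \<Rightarrow> 't::ab_group_add \<Rightarrow> 't)
     \<Rightarrow> (('i \<Rightarrow> 'w) \<Rightarrow> 't) \<Rightarrow> bool" where
  "tensor_product I s sT \<tau> \<longleftrightarrow>
     (\<forall>i\<in>I. vector_space (s i)) \<and> vector_space sT \<and> multilinear I s sT \<tau> \<and>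
     (\<forall>f. multilinear I s (*) f \<longrightarrow>
        (\<exists>!g. Vector_Spaces.linear sT (*) g \<and> (\<forall>w. f w = g (\<tau> w))))"

lemma vector_space_complex: "vector_space ((*) :: complex \<Rightarrow> complex \<Rightarrow> complex)"
  by unfold_locales (simp_all add: algebra_simps)

lemma multilinear_compose:
  assumes "multilinear I s sX f" "Vector_Spaces.linear sX sZ g"
  shows "multilinear I s sZ (\<lambda>w. g (f w))"
proof -
  have "Vector_Spaces.linear (s i) sZ (\<lambda>x. g (f (w(i := x))))" if "i \<in> I" for i w
    using Vector_Spaces.linear_compose[of "s i" sX "\<lambda>x. f (w(i := x))" sZ g] assms that
    by (simp add: multilinear_def o_def)
  moreover have "g (f w) = g (f w')" if "\<forall>i\<in>I. w i = w' i" for w w'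
    using assms(1) that unfolding multilinear_def by (intro arg_cong[of _ _ g]) blast
  ultimately show ?thesis
    unfolding multilinear_def by blast
qed

lemma functional_separates:
  assumes "vector_space (s :: complex \<Rightarrow> 'x::ab_group_add \<Rightarrow> 'x)" "x \<notin> module.span s S"
  shows "\<exists>\<phi>. Vector_Spaces.linear s (*) \<phi> \<and> \<phi> x = (1::complex) \<and> (\<forall>y\<in>module.span s S. \<phi> y = 0)"
proof -
  interpret X: vector_space s by fact
  interpret C: vector_space "(*) :: complex \<Rightarrow> complex \<Rightarrow> complex" by (rule vector_space_complex)
  interpret XC: vector_space_pair s "(*) :: complex \<Rightarrow> complex \<Rightarrow> complex" ..
  obtain B where B: "B \<subseteq> S" "X.independent B" "S \<subseteq> X.span B"
    using X.maximal_independent_subset by blast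
  have spB: "X.span S = X.span B"
    by (rule subset_antisym[OF X.span_minimal[OF B(3) X.subspace_span] X.span_mono[OF B(1)]])
  have ind: "X.independent (insert x B)"
    using B assms(2) spB by (simp add: X.independent_insert)
  define \<phi> where "\<phi> = XC.construct (insert x B) (\<lambda>b. if b = x then 1 else 0)"
  have lin: "Vector_Spaces.linear s (*) \<phi>"
    unfolding \<phi>_def by (rule XC.linear_construct[OF ind])
  have x: "\<phi> x = 1"
    unfolding \<phi>_def by (subst XC.construct_basis[OF ind]) auto
  have xB: "x \<notin> B"
    using assms(2) spB X.span_base by blast
  have b: "\<phi> b = 0" if "b \<in> B" for b
    unfolding \<phi>_def using that xB by (subst XC.construct_basis[OF ind]) auto
  have "\<phi> y = 0" if "y \<in> X.span B" for y
    using XC.linear_eq_0_on_span[OF lin b that] by blast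
  then show ?thesis
    using lin x spB by auto
qed

lemma tensor_product_span:
  assumes T: "tensor_product I s sT \<tau>"
  shows "module.span sT (range \<tau>) = UNIV"
proof (rule ccontr)
  interpret T: vector_space sT using T by (simp add: tensor_product_def)
  interpret C: vector_space "(*) :: complex \<Rightarrow> complex \<Rightarrow> complex" by (rule vector_space_complex)
  interpret TC: vector_space_pair sT "(*) :: complex \<Rightarrow> complex \<Rightarrow> complex" ..
  assume "T.span (range \<tau>) \<noteq> UNIV"
  then obtain x where "x \<notin> T.span (range \<tau>)" by blast
  then obtain \<phi> where \<phi>: "Vector_Spaces.linear sT (*) \<phi>" "\<phi> x = (1::complex)"
      "\<forall>y\<in>T.span (range \<tau>). \<phi> y = 0"
    using functional_separates[OF T.vector_space_axioms] by blast
  have m: "multilinear I s (*) (\<lambda>w. \<phi> (\<tau> w))"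
    by (rule multilinear_compose[of I s sT \<tau>]) (use T \<phi>(1) in \<open>simp_all add: tensor_product_def\<close>)
  have e: "\<exists>!g. Vector_Spaces.linear sT (*) g \<and> (\<forall>w. \<phi> (\<tau> w) = g (\<tau> w))"
    using T m unfolding tensor_product_def by blast
  have z: "Vector_Spaces.linear sT (*) (\<lambda>x. 0::complex)"
    by (rule TC.linear_zero)
  have "\<forall>w. \<phi> (\<tau> w) = 0"
    using \<phi>(3) T.span_base by blast
  then have "\<phi> = (\<lambda>x. 0)"
    using e \<phi>(1) z by blast
  then show False using \<phi>(2) by simp
qed

lemma tensor_product_universal:
  assumes T: "tensor_product I s sT \<tau>" and f: "multilinear I s sX f" and X: "vector_space sX"
  shows "\<exists>!g. Vector_Spaces.linear sT sX g \<and> (\<forall>w. f w = g (\<tau> w))"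
proof -
  interpret T: vector_space sT using T by (simp add: tensor_product_def)
  interpret X: vector_space sX by fact
  interpret C: vector_space "(*) :: complex \<Rightarrow> complex \<Rightarrow> complex" by (rule vector_space_complex)
  interpret TX: vector_space_pair sT sX ..
  interpret TC: vector_space_pair sT "(*) :: complex \<Rightarrow> complex \<Rightarrow> complex" ..
  obtain B where B: "B \<subseteq> range \<tau>" "T.independent B" "range \<tau> \<subseteq> T.span B"
    using T.maximal_independent_subset by blast
  have spB: "T.span B = UNIV"
    using tensor_product_span[OF T] B(3) T.span_minimal[OF B(3) T.subspace_span] by auto
  define g where "g = TX.construct B (\<lambda>b. f (inv \<tau> b))"
  have g: "Vector_Spaces.linear sT sX g"
    unfolding g_def by (rule TX.linear_construct[OF B(2)])
  have gB: "g b = f (inv \<tau> b)" if "b \<in> B" for b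
    unfolding g_def using TX.construct_basis[OF B(2) that] .
  have fg: "f w = g (\<tau> w)" for w
  proof (rule ccontr)
    assume "f w \<noteq> g (\<tau> w)"
    then have "f w - g (\<tau> w) \<notin> X.span {}" by simp
    then obtain \<phi> where \<phi>: "Vector_Spaces.linear sX (*) \<phi>" "\<phi> (f w - g (\<tau> w)) = (1::complex)"
      using functional_separates[OF X] by blast
    obtain k where k: "Vector_Spaces.linear sT (*) k" "\<And>w. \<phi> (f w) = k (\<tau> w)"
      using T multilinear_compose[OF f \<phi>(1)] unfolding tensor_product_def by blast
    have l: "Vector_Spaces.linear sT (*) (\<lambda>x. \<phi> (g x))"
      using Vector_Spaces.linear_compose[OF g \<phi>(1)] by (simp add: o_def)
    have "k b = \<phi> (g b)" if "b \<in> B" for b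
    proof -
      have "\<tau> (inv \<tau> b) = b" using that B(1) f_inv_into_f[of b \<tau> UNIV] by blast
      then show ?thesis using gB[OF that] k(2)[of "inv \<tau> b"] by simp
    qed
    then have "k (\<tau> w) = \<phi> (g (\<tau> w))"
      using TC.linear_eq_on[OF k(1) l, of "\<tau> w" B] spB by blast
    moreover have "\<phi> (f w - g (\<tau> w)) = \<phi> (f w) - \<phi> (g (\<tau> w))"
      by (rule module_hom.diff) (use \<phi>(1) in \<open>simp add: linear_iff_module_hom\<close>)
    ultimately show False using \<phi>(2) k(2) by simp
  qed
  show ?thesis
  proof (rule ex1I)
    show "Vector_Spaces.linear sT sX g \<and> (\<forall>w. f w = g (\<tau> w))"
      using g fg by blast
  next
    fix k assume k: "Vector_Spaces.linear sT sX k \<and> (\<forall>w. f w = k (\<tau> w))"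
    have "k x = g x" for x
    proof (rule TX.linear_eq_on[of k g x "range \<tau>"])
      show "x \<in> T.span (range \<tau>)" using tensor_product_span[OF T] by simp
      show "k b = g b" if "b \<in> range \<tau>" for b using that k fg by auto
    qed (use k g in auto)
    then show "k = g" by blast
  qed
qed

text \<open>
  The vertex operators \<open>Y(\<Otimes>u\<^sub>i,x)\<Otimes>w\<^sub>i = \<Otimes>Y(u\<^sub>i,x)w\<^sub>i\<close>: the coefficient of
  \<open>x\<^bsup>-m-1\<^esup>\<close> on the right hand side is the sum of all \<open>\<Otimes>(u\<^sub>i)\<^bsub>k i\<^esub> w\<^sub>i\<close> with
  \<open>\<Sum>\<^sub>i(k i + 1) = m + 1\<close>, of which only finitely many are nonzero.
\<close>

definition tensor_vertex_operator ::
    "'i set \<Rightarrow> ('i \<Rightarrow> 'v \<Rightarrow> int \<Rightarrow> 'w \<Rightarrow> 'w) \<Rightarrow> (('i \<Rightarrow> 'v) \<Rightarrow> 't) \<Rightarrow> (('i \<Rightarrow> 'w) \<Rightarrow> 'x::ab_group_add)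
     \<Rightarrow> ('t \<Rightarrow> int \<Rightarrow> 'x \<Rightarrow> 'x) \<Rightarrow> bool" where
  "tensor_vertex_operator I YW \<tau>V \<tau>W YX \<longleftrightarrow>
     (\<forall>u m w. YX (\<tau>V u) m (\<tau>W w) =
        Sum_any (\<lambda>k. if k \<in> I \<rightarrow>\<^sub>E (UNIV :: int set) \<and> (\<Sum>i\<in>I. (k i + 1)) = m + 1
                     then \<tau>W (\<lambda>i. YW i (u i) (k i) (w i)) else 0))"

definition omega_factor :: "(('i \<Rightarrow> 'v) \<Rightarrow> 't) \<Rightarrow> 'v \<Rightarrow> 'v \<Rightarrow> 'i \<Rightarrow> 't" where
  "omega_factor \<tau> one omega i = \<tau> ((\<lambda>_. one)(i := omega))"

text \<open>The tensor power, over the finite index set \<open>I\<close>, of a vertex operator algebra.\<close>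

definition tensor_power_voa where
  "tensor_power_voa I s Y one omega c \<tau> sT YT oneT omegaT \<longleftrightarrow>
     finite I \<and> voa s Y one omega c \<and>
     voa sT YT oneT omegaT (of_nat (card I) * c) \<and>
     tensor_product I (\<lambda>_. s) sT \<tau> \<and>
     tensor_vertex_operator I (\<lambda>_. Y) \<tau> \<tau> YT \<and>
     oneT = \<tau> (\<lambda>_. one) \<and>
     omegaT = (\<Sum>i\<in>I. omega_factor \<tau> one omega i)"

text \<open>
  The tensor product of modules \<open>(sW i, YW i)\<close>, as a module for the tensor power.
\<close>

definition tensor_product_module where
  "tensor_product_module I s Y one omega c \<tau> sT YT oneT omegaT sW YW \<tau>W sX YX \<longleftrightarrow>
     tensor_power_voa I s Y one omega c \<tau> sT YT oneT omegaT \<and>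
     (\<forall>i\<in>I. voa_module s Y one omega c (sW i) (YW i)) \<and>
     voa_module sT YT oneT omegaT (of_nat (card I) * c) sX YX \<and>
     tensor_product I sW sX \<tau>W \<and>
     tensor_vertex_operator I YW \<tau> \<tau>W YX"

section \<open>Integral forms\<close>

definition add_subgroup :: "'a::ab_group_add set \<Rightarrow> bool" where
  "add_subgroup A \<longleftrightarrow> 0 \<in> A \<and> (\<forall>x\<in>A. \<forall>y\<in>A. x + y \<in> A) \<and> (\<forall>x\<in>A. - x \<in> A)"

definition vertex_subring ::
    "('v::ab_group_add \<Rightarrow> int \<Rightarrow> 'v \<Rightarrow> 'v) \<Rightarrow> 'v \<Rightarrow> 'v set \<Rightarrow> bool" where
  "vertex_subring Y one A \<longleftrightarrow>
     add_subgroup A \<and> one \<in> A \<and> (\<forall>u\<in>A. \<forall>v\<in>A. \<forall>m. Y u m v \<in> A)"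

definition vertex_subring_closed ::
    "('v \<Rightarrow> int \<Rightarrow> 'w::ab_group_add \<Rightarrow> 'w) \<Rightarrow> 'v set \<Rightarrow> 'w set \<Rightarrow> bool" where
  "vertex_subring_closed YW VZ M \<longleftrightarrow>
     add_subgroup M \<and> (\<forall>u\<in>VZ. \<forall>m. \<forall>w\<in>M. YW u m w \<in> M)"

definition int_span :: "(complex \<Rightarrow> 'w::ab_group_add \<Rightarrow> 'w) \<Rightarrow> 'w set \<Rightarrow> 'w set" where
  "int_span s B = {\<Sum>b\<in>F. s (of_int (z b)) b | F z. finite F \<and> F \<subseteq> B}"

text \<open>
  The last clause is \<open>M = \<Coprod>\<^sub>h W\<^sub>(\<^sub>h\<^sub>) \<inter> M\<close>: \<open>M\<close> is the sum of its subgroups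
  \<open>W\<^sub>(\<^sub>h\<^sub>) \<inter> M\<close>, a sum of subgroups of distinct eigenspaces being direct.
\<close>

definition module_integral_form ::
    "(complex \<Rightarrow> 'w::ab_group_add \<Rightarrow> 'w) \<Rightarrow> ('v \<Rightarrow> int \<Rightarrow> 'w \<Rightarrow> 'w) \<Rightarrow> 'v \<Rightarrow> 'v set \<Rightarrow> 'w set \<Rightarrow> bool"
  where
  "module_integral_form s YW omega VZ M \<longleftrightarrow>
     vertex_subring_closed YW VZ M \<and>
     (\<exists>B. \<not> module.dependent s B \<and> module.span s B = UNIV \<and> M = int_span s B) \<and>
     M = add_subgroup hull (\<Union>h. weight_space s (vir_mode YW omega) h \<inter> M)"

section \<open>Codes and the vertex subring of a code\<close>

text \<open>Over the field with two elements, subspaces are the subsets containing 0 and closed under addition.\<close>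

definition binary_linear_code :: "'i set \<Rightarrow> 'i set set \<Rightarrow> bool" where
  "binary_linear_code \<Omega> C \<longleftrightarrow>
     C \<subseteq> Pow \<Omega> \<and> {} \<in> C \<and> (\<forall>S\<in>C. \<forall>T\<in>C. sym_diff S T \<in> C)"

definition even_code :: "'i set \<Rightarrow> 'i set set" where
  "even_code \<Omega> = {T. T \<subseteq> \<Omega> \<and> even (card T)}"

definition omega_code ::
    "'i set \<Rightarrow> (('i \<Rightarrow> 'v) \<Rightarrow> 't::ab_group_add) \<Rightarrow> 'v \<Rightarrow> 'v \<Rightarrow> 'i set \<Rightarrow> 't" where
  "omega_code \<Omega> \<tau> one omega T =
     (\<Sum>i\<in>\<Omega> - T. omega_factor \<tau> one omega i) - (\<Sum>i\<in>T. omega_factor \<tau> one omega i)"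

definition code_vertex_subring where
  "code_vertex_subring \<Omega> \<tau> one omega YT oneT C =
     vertex_subring YT oneT hull (omega_code \<Omega> \<tau> one omega ` C)"

definition generated_module ::
    "('v \<Rightarrow> int \<Rightarrow> 'w::ab_group_add \<Rightarrow> 'w) \<Rightarrow> 'v set \<Rightarrow> 'w \<Rightarrow> 'w set" where
  "generated_module YW VZ w = vertex_subring_closed YW VZ hull {w}"

end

theory Submission
  imports Defs
begin

text \<open>
  The modes \<open>L\<^sub>T(m)\<close> of the \<open>\<omega>\<^sub>T\<close>, \<open>T \<in> C\<close>, satisfy
  \<open>[L\<^sub>S(m), L\<^sub>T(k)] = (m - k) L\<^sub>S\<^sub>+\<^sub>T(m + k) + \<delta> (m\<^sup>3 - m)/24 (n - 2|S + T|)\<close>, and the central term is an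
  integer because \<open>n\<close> and \<open>2|S + T|\<close> are multiples of \<open>4\<close>; moreover \<open>L\<^sub>T(0)\<close> acts on \<open>v\<^sub>H\<close> by an
  integer because \<open>h\<^sub>i = 1/2\<close> for an even number of \<open>i\<close>.  Hence the subgroup spanned by the products of lowering
  operators \<open>L\<^sub>T(-k)\<close>, \<open>k > 0\<close>, applied to \<open>v\<^sub>H\<close> is closed under all modes, so it is the generated
  module \<open>M\<close>, and the functional \<open>\<Xi>\<close> reading off the coefficient of \<open>v\<^sub>H\<close> is integral on \<open>M\<close>.  The
  functionals \<open>w \<mapsto> \<Xi>(L\<^bsub>T\<^sub>1\<^esub>(m\<^sub>1) \<dots> L\<^bsub>T\<^sub>k\<^esub>(m\<^sub>k) w)\<close> are therefore integral on \<open>M\<close>, and they separate the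
  points of the irreducible module \<open>W\<^sub>H\<close>.  A subgroup of a finite dimensional space on which a
  separating family of functionals is integral is the \<open>\<int>\<close>-span of an independent set; this applies to
  each graded piece of \<open>M\<close>.  That \<open>M\<close> spans \<open>W\<^sub>H\<close> follows from the orthogonality of the characters
  \<open>T \<mapsto> (-1)\<^bsup>|T \<inter> {i}|\<^esup>\<close> of \<open>C\<close>, which expresses the modes of \<open>\<omega>\<^sup>(\<^sup>i\<^sup>)\<close> by those of the \<open>\<omega>\<^sub>T\<close>.
\<close>

section \<open>Integral functionals and integral bases\<close>

lemma add_subgroup_diff: "add_subgroup A \<Longrightarrow> x \<in> A \<Longrightarrow> y \<in> A \<Longrightarrow> x - y \<in> A"
  unfolding add_subgroup_def diff_conv_add_uminus by blast

lemma add_subgroup_sum: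
  "add_subgroup A \<Longrightarrow> (\<And>i. i \<in> I \<Longrightarrow> f i \<in> A) \<Longrightarrow> sum f I \<in> A"
  by (induction I rule: infinite_finite_induct) (auto simp: add_subgroup_def)

lemma add_subgroup_Sum_any: "add_subgroup A \<Longrightarrow> (\<And>i. f i \<in> A) \<Longrightarrow> Sum_any f \<in> A"
  unfolding Sum_any.expand_set by (rule add_subgroup_sum)

lemma add_subgroup_Int: "add_subgroup A \<Longrightarrow> add_subgroup B \<Longrightarrow> add_subgroup (A \<inter> B)"
  by (auto simp: add_subgroup_def)

lemma add_subgroup_hull: "add_subgroup (add_subgroup hull S)"
  by (rule hull_in) (auto simp: add_subgroup_def)

locale complex_space = vector_space scale for scale :: "complex \<Rightarrow> 'b::ab_group_add \<Rightarrow> 'b"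
begin

lemma subspace_add_subgroup: "subspace U \<Longrightarrow> add_subgroup U"
  by (auto simp: add_subgroup_def subspace_0 subspace_add subspace_neg)

lemma add_subgroup_scale_int:
  assumes "add_subgroup A" "x \<in> A"
  shows "scale (of_int k) x \<in> A"
proof -
  have n: "scale (of_nat j) x \<in> A" for j
    using assms by (induction j) (auto simp: add_subgroup_def scale_left_distrib)
  show ?thesis
  proof (cases k)
    case (nonneg j)
    then show ?thesis using n by simp
  next
    case (neg j)
    then show ?thesis using n[of "Suc j"] assms(1) by (simp add: add_subgroup_def del: of_nat_Suc)
  qed
qed

lemma add_subgroup_scale_Ints: "add_subgroup A \<Longrightarrow> x \<in> A \<Longrightarrow> a \<in> \<int> \<Longrightarrow> scale a x \<in> A"
  by (auto elim!: Ints_cases simp: add_subgroup_scale_int)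

text \<open>Eigenvectors of \<open>L 0\<close> for distinct eigenvalues are independent. After
  reduction to finitely many eigenvalues, the induction removes one at a time.\<close>

lemma weight_space_inter_span:
  assumes L: "Vector_Spaces.linear scale scale (L 0)" and h: "h \<notin> H"
    and x: "x \<in> weight_space scale L h" "x \<in> span (\<Union>k\<in>H. weight_space scale L k)"
  shows "x = 0"
proof -
  interpret vector_space_pair scale scale ..
  interpret L0: module_hom scale scale "L 0"
    using L by (simp add: linear_iff_module_hom)
  have fin: "x = 0" if "finite K" "h \<notin> K" "x \<in> weight_space scale L h"
      "x \<in> span (\<Union>k\<in>K. weight_space scale L k)" for K x
    using that
  proof (induction K arbitrary: x rule: finite_induct)
    case (insert k K)
    \<comment> \<open>\<open>p\<close> is \<open>L 0 - k\<close>: it kills the weight space of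
      \<open>k\<close>, preserves the others, and multiplies \<open>x\<close> by
      \<open>h - k\<close>, so the induction hypothesis applies to \<open>p x\<close>.\<close>
    define p where "p = (\<lambda>y. L 0 y - scale k y)"
    have p: "Vector_Spaces.linear scale scale p"
      unfolding p_def by (intro linear_compose_sub L linear_scale_self)
    have "p ` (\<Union>j\<in>insert k K. weight_space scale L j) \<subseteq> span (\<Union>j\<in>K. weight_space scale L j)"
    proof (clarify)
      fix y j assume j: "j \<in> insert k K" "y \<in> weight_space scale L j"
      show "p y \<in> span (\<Union>j\<in>K. weight_space scale L j)"
      proof (cases "j = k")
        case True
        then show ?thesis using j by (simp add: p_def weight_space_def span_zero)
      next
        case False
        then have "y \<in> span (\<Union>j\<in>K. weight_space scale L j)" using j by (intro span_base) auto
        moreover have "p y = scale (j - k) y"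
          using j by (simp add: p_def weight_space_def scale_left_diff_distrib)
        ultimately show ?thesis by (simp add: span_scale)
      qed
    qed
    then have "span (p ` (\<Union>j\<in>insert k K. weight_space scale L j))
        \<subseteq> span (\<Union>j\<in>K. weight_space scale L j)"
      by (rule span_minimal[OF _ subspace_span])
    then have "p x \<in> span (\<Union>j\<in>K. weight_space scale L j)"
      using insert.prems(3) linear_span_image[OF p] by blast
    moreover have px: "p x = scale (h - k) x"
      using insert.prems(2) by (simp add: p_def weight_space_def scale_left_diff_distrib)
    moreover have "scale (h - k) x \<in> weight_space scale L h"
      using insert.prems(2) by (simp add: weight_space_def L0.scale scale_left_commute)
    ultimately have "scale (h - k) x = 0"
      using insert.IH[of "scale (h - k) x"] insert.prems(1) by simp
    then show ?case using insert.prems(1) by auto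
  qed simp
  obtain S where S: "finite S" "S \<subseteq> (\<Union>k\<in>H. weight_space scale L k)" "x \<in> span S"
    using x(2) by (auto simp: span_explicit intro: span_sum span_scale span_base)
  then obtain k where k: "\<And>y. y \<in> S \<Longrightarrow> k y \<in> H \<and> y \<in> weight_space scale L (k y)"
    by (metis (no_types, lifting) UN_iff subsetD)
  have "x \<in> span (\<Union>j\<in>k ` S. weight_space scale L j)"
    using S(3) span_mono[of S "\<Union>j\<in>k ` S. weight_space scale L j"] k by blast
  moreover have "h \<notin> k ` S" using k h by auto
  ultimately show ?thesis using fin[of "k ` S"] S(1) x(1) by blast
qed

section \<open>Integral spans and integral bases\<close>

lemma int_span_add_subgroup: "add_subgroup (int_span scale B)"
  unfolding add_subgroup_def
proof (intro conjI ballI)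
  show "0 \<in> int_span scale B" by (auto simp: int_span_def intro!: exI[of _ "{}"])
next
  fix x y assume "x \<in> int_span scale B" "y \<in> int_span scale B"
  then obtain F z G w where F: "finite F" "F \<subseteq> B" "x = (\<Sum>b\<in>F. scale (of_int (z b)) b)"
    and G: "finite G" "G \<subseteq> B" "y = (\<Sum>b\<in>G. scale (of_int (w b)) b)"
    by (auto simp: int_span_def)
  have "x = (\<Sum>b\<in>F \<union> G. scale (of_int (if b \<in> F then z b else 0)) b)"
    unfolding F(3) using F G by (intro sum.mono_neutral_cong_left) auto
  moreover have "y = (\<Sum>b\<in>F \<union> G. scale (of_int (if b \<in> G then w b else 0)) b)"
    unfolding G(3) using F G by (intro sum.mono_neutral_cong_left) auto
  ultimately have "x + y = (\<Sum>b\<in>F \<union> G. scale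
      (of_int ((if b \<in> F then z b else 0) + (if b \<in> G then w b else 0))) b)"
    by (simp only: of_int_add scale_left_distrib sum.distrib)
  then show "x + y \<in> int_span scale B"
    unfolding int_span_def using F(1,2) G(1,2)
    by (intro CollectI exI[of _ "F \<union> G"]
        exI[of _ "\<lambda>b. (if b \<in> F then z b else 0) + (if b \<in> G then w b else 0)"]) simp
next
  fix x assume "x \<in> int_span scale B"
  then obtain F z where F: "finite F" "F \<subseteq> B" "x = (\<Sum>b\<in>F. scale (of_int (z b)) b)"
    by (auto simp: int_span_def)
  then have "- x = (\<Sum>b\<in>F. scale (of_int (- z b)) b)" by (simp add: sum_negf)
  then show "- x \<in> int_span scale B" unfolding int_span_def using F(1,2)
    by (intro CollectI exI[of _ F] exI[of _ "\<lambda>b. - z b"]) simp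
qed

lemma int_span_base: "B \<subseteq> int_span scale B"
proof
  fix b assume "b \<in> B"
  then have "b = (\<Sum>b\<in>{b}. scale (of_int 1) b) \<and> finite {b} \<and> {b} \<subseteq> B" by simp
  then show "b \<in> int_span scale B" unfolding int_span_def
    by (intro CollectI exI[of _ "{b}"] exI[of _ "\<lambda>_. 1"])
qed

lemma int_span_minimal:
  assumes "add_subgroup A" "B \<subseteq> A"
  shows "int_span scale B \<subseteq> A"
  unfolding int_span_def using assms by (auto intro!: add_subgroup_sum add_subgroup_scale_int)

text \<open>
  Elimination: a functional \<open>f \<in> F\<close> that is not zero on \<open>G\<close> maps \<open>G\<close> onto some \<open>d\<int>\<close>, and a vector of
  \<open>G\<close> with value \<open>d\<close> completes a basis of the kernel of \<open>f\<close> in \<open>G\<close>.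
\<close>

lemma integral_basis:
  assumes F: "\<And>f. f \<in> F \<Longrightarrow> Vector_Spaces.linear scale (*) f"
      "\<And>x. (\<And>f. f \<in> F \<Longrightarrow> f x = 0) \<Longrightarrow> x = 0"
    and "finite B" "add_subgroup G" "G \<subseteq> span B" "\<And>f g. f \<in> F \<Longrightarrow> g \<in> G \<Longrightarrow> f g \<in> \<int>"
  shows "\<exists>E. independent E \<and> G = int_span scale E"
  using assms(3-)
proof (induction "card B" arbitrary: B G rule: less_induct)
  case less
  show ?case
  proof (cases "G \<subseteq> {0}")
    case True
    then have "G = int_span scale {}"
      using less.prems(2) by (auto simp: int_span_def add_subgroup_def)
    then show ?thesis using independent_empty by blast
  next
    case False
    then obtain g0 f where g0: "g0 \<in> G" and f: "f \<in> F" "f g0 \<noteq> 0"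
      using F(2) by blast
    interpret f: Vector_Spaces.linear scale "(*)" f using F(1) f(1) .
    interpret vector_space_pair scale scale ..
    obtain b where b: "b \<in> B" "f b \<noteq> 0"
      using f.eq_0_on_span[of B g0] g0 f(2) less.prems(3) by blast
    \<comment> \<open>\<open>p\<close> is the projection onto the kernel of \<open>f\<close> along
      \<open>b\<close>. It kills \<open>b\<close> and fixes \<open>G'\<close>, so \<open>G'\<close>
      lies in the span of fewer than \<open>card B\<close> vectors.\<close>
    define p where "p = (\<lambda>x. x - scale (f x / f b) b)"
    have p: "Vector_Spaces.linear scale scale p"
      unfolding p_def Vector_Spaces.linear_def module_hom_def module_hom_axioms_def
      by (simp add: vector_space_axioms module_axioms f.add f.scale add_divide_distrib
          scale_left_distrib scale_right_diff_distrib)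
    define G' where "G' = {g \<in> G. f g = 0}"
    have G': "add_subgroup G'"
      using less.prems(2) by (auto simp: add_subgroup_def G'_def f.add f.neg f.zero)
    have "p ` B \<subseteq> span (p ` (B - {b}))"
    proof
      fix y assume "y \<in> p ` B"
      then obtain a where a: "a \<in> B" "y = p a" by blast
      show "y \<in> span (p ` (B - {b}))"
      proof (cases "a = b")
        case True
        then show ?thesis using a b by (simp add: p_def span_zero)
      next
        case False
        then show ?thesis using a by (intro span_base) auto
      qed
    qed
    then have pB: "span (p ` B) \<subseteq> span (p ` (B - {b}))"
      by (rule span_minimal[OF _ subspace_span])
    have sub: "G' \<subseteq> span (p ` (B - {b}))"
    proof
      fix g assume g: "g \<in> G'"
      then have "g = p g" by (simp add: p_def G'_def)
      moreover have "p g \<in> p ` span B" using g less.prems(3) by (auto simp: G'_def)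
      ultimately show "g \<in> span (p ` (B - {b}))"
        using pB linear_span_image[OF p, of B] by auto
    qed
    have "card (p ` (B - {b})) < card B"
      using card_image_le[of "B - {b}" p] card_Diff1_less[OF less.prems(1) b(1)] less.prems(1)
      by (meson finite_Diff le_less_trans)
    then obtain E where E: "independent E" "G' = int_span scale E"
      using less.hyps[of "p ` (B - {b})" G'] G' sub less.prems(1,4) by (auto simp: G'_def)
    \<comment> \<open>\<open>P m\<close> says that \<open>m\<close> is a positive value of
      \<open>f\<close> on \<open>G\<close>; the least such value \<open>d\<close> generates the
      group of all values.\<close>
    define P where "P = (\<lambda>m::nat. m > 0 \<and> (\<exists>g\<in>G. f g = of_nat m))"
    have "\<exists>m. P m"
    proof -
      obtain z where z: "f g0 = of_int z" using less.prems(4)[OF f(1) g0] by (rule Ints_cases)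
      have mg: "- g0 \<in> G" using g0 less.prems(2) by (simp add: add_subgroup_def)
      have "P (nat \<bar>z\<bar>)"
        using z f(2) g0 mg unfolding P_def
        by (cases "z > 0") (auto intro: bexI[of _ g0] bexI[of _ "- g0"] simp: f.neg)
      then show ?thesis ..
    qed
    then have Pd: "P (LEAST m. P m)" by (rule LeastI_ex)
    define d where "d = (LEAST m. P m)"
    obtain e where e: "d > 0" "e \<in> G" "f e = of_nat d"
      using Pd unfolding d_def[symmetric] unfolding P_def by blast
    have E0: "f x = 0" if "x \<in> span E" for x
      using f.eq_0_on_span[of E x] that E(2) int_span_base[of E] by (auto simp: G'_def)
    have "e \<notin> span E" using E0 e by auto
    then have ind: "independent (insert e E)" using E(1) by (simp add: independent_insertI)
    have "G = int_span scale (insert e E)"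
    proof
      show "int_span scale (insert e E) \<subseteq> G"
        using int_span_minimal[OF less.prems(2), of "insert e E"] e(2) E(2) int_span_base[of E]
        by (auto simp: G'_def)
      show "G \<subseteq> int_span scale (insert e E)"
      proof
        fix g assume g: "g \<in> G"
        obtain z where z: "f g = of_int z"
          using less.prems(4)[OF f(1) g] by (rule Ints_cases)
        \<comment> \<open>The value of \<open>f\<close> at the remainder \<open>r\<close> is
          \<open>z mod d\<close>, which minimality of \<open>d\<close> forces to be
          \<open>0\<close>; hence \<open>r\<close> lies in \<open>G'\<close>.\<close>
        define r where "r = g - scale (of_int (z div int d)) e"
        have rG: "r \<in> G"
          unfolding r_def using less.prems(2) g e(2)
          by (intro add_subgroup_diff add_subgroup_scale_int)
        have "f r = of_int (z - (z div int d) * int d)"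
          by (simp add: r_def f.diff f.scale z e(3))
        then have fr: "f r = of_int (z mod int d)"
          by (simp only: minus_div_mult_eq_mod)
        have "z mod int d = 0"
        proof (rule ccontr)
          assume "z mod int d \<noteq> 0"
          moreover have "z mod int d \<ge> 0" "z mod int d < int d" using e(1) by auto
          ultimately have "P (nat (z mod int d))" "nat (z mod int d) < d"
            unfolding P_def using rG fr by (auto intro!: bexI[of _ r])
          then show False using not_less_Least[of _ P] d_def by blast
        qed
        then have "r \<in> int_span scale E" using rG fr E(2) by (auto simp: G'_def)
        then have "r \<in> int_span scale (insert e E)" by (auto simp: int_span_def)
        moreover have "scale (of_int (z div int d)) e \<in> int_span scale (insert e E)"
          using int_span_base[of "insert e E"]
          by (intro add_subgroup_scale_int int_span_add_subgroup) auto
        moreover have "g = r + scale (of_int (z div int d)) e" by (simp add: r_def)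
        ultimately show "g \<in> int_span scale (insert e E)"
          using int_span_add_subgroup[of "insert e E"] by (simp add: add_subgroup_def)
      qed
    qed
    then show ?thesis using ind by blast
  qed
qed

text \<open>Weight spaces are finite dimensional, so \<open>integral_basis\<close> applies to each
  homogeneous part of \<open>G\<close>. The union of the resulting bases is independent because the
  weights differ, and it generates \<open>G\<close> because \<open>G\<close> is the sum of its
  homogeneous parts.\<close>

lemma graded_integral_basis:
  assumes L: "Vector_Spaces.linear scale scale (L 0)"
    and fin: "\<And>h. \<exists>B. finite B \<and> weight_space scale L h = span B"
    and F: "\<And>f. f \<in> F \<Longrightarrow> Vector_Spaces.linear scale (*) f"
      "\<And>x. (\<And>f. f \<in> F \<Longrightarrow> f x = 0) \<Longrightarrow> x = 0" "\<And>f g. f \<in> F \<Longrightarrow> g \<in> G \<Longrightarrow> f g \<in> \<int>"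
    and G: "add_subgroup G" "G \<subseteq> add_subgroup hull (\<Union>h. weight_space scale L h \<inter> G)" "span G = UNIV"
  shows "\<exists>B. independent B \<and> span B = UNIV \<and> G = int_span scale B"
proof -
  have "\<exists>E. independent E \<and> weight_space scale L h \<inter> G = int_span scale E" for h
  proof -
    obtain B where B: "finite B" "weight_space scale L h = span B" using fin by blast
    then show ?thesis
      using G(1) F(3)
      by (intro integral_basis[OF F(1,2) B(1)] add_subgroup_Int) (auto simp: subspace_add_subgroup)
  qed
  then obtain E where E: "\<And>h. independent (E h)" "\<And>h. weight_space scale L h \<inter> G = int_span scale (E h)"
    by metis
  have Eh: "E h \<subseteq> weight_space scale L h \<inter> G" for h
    using E(2) int_span_base[of "E h"] by simp
  define B where "B = (\<Union>h. E h)"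
  have "independent B"
    unfolding dependent_def
  proof
    assume "\<exists>b\<in>B. b \<in> span (B - {b})"
    then obtain b h where b: "b \<in> E h" "b \<in> span (B - {b})" by (auto simp: B_def)
    \<comment> \<open>A dependence of \<open>b\<close> on the rest splits into a part
      \<open>y\<close> of the same weight and a part \<open>z\<close> of other weights. As
      \<open>z = b - y\<close> also has weight \<open>h\<close>, it is zero, which contradicts the
      independence of \<open>E h\<close>.\<close>
    have "B - {b} \<subseteq> (E h - {b}) \<union> (\<Union>k\<in>-{h}. weight_space scale L k)"
      using Eh by (auto simp: B_def) blast
    then have "b \<in> span ((E h - {b}) \<union> (\<Union>k\<in>-{h}. weight_space scale L k))"
      using b(2) span_mono by blast
    then obtain y z where yz: "b = y + z" "y \<in> span (E h - {b})"
        "z \<in> span (\<Union>k\<in>-{h}. weight_space scale L k)"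
      unfolding span_Un by blast
    obtain D where D: "weight_space scale L h = span D" using fin by blast
    have "span (E h - {b}) \<subseteq> weight_space scale L h"
      using Eh[of h] unfolding D by (intro span_minimal) auto
    then have "z \<in> weight_space scale L h"
      using yz(1,2) b(1) Eh[of h] subspace_diff[of "span D" b y] unfolding D by auto
    then have "z = 0"
      using weight_space_inter_span[where L = L and h = h and H = "-{h}"] L yz(3) by blast
    then show False using yz(1,2) b(1) E(1)[of h] by (auto simp: dependent_def)
  qed
  moreover have eq: "G = int_span scale B"
  proof
    show "int_span scale B \<subseteq> G"
      using Eh by (intro int_span_minimal[OF G(1)]) (auto simp: B_def)
    have "weight_space scale L h \<inter> G \<subseteq> int_span scale B" for h
    proof -
      have "E h \<subseteq> int_span scale B" using int_span_base[of B] by (auto simp: B_def)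
      then show ?thesis unfolding E(2) by (intro int_span_minimal int_span_add_subgroup)
    qed
    then have "add_subgroup hull (\<Union>h. weight_space scale L h \<inter> G) \<subseteq> int_span scale B"
      by (intro hull_minimal int_span_add_subgroup) auto
    then show "G \<subseteq> int_span scale B" using G(2) by blast
  qed
  moreover have "span B = UNIV"
  proof -
    have "G \<subseteq> span B"
      unfolding eq by (intro int_span_minimal subspace_add_subgroup subspace_span) (rule span_superset)
    then show ?thesis using G(3) span_minimal[OF _ subspace_span, of G B] by auto
  qed
  ultimately show ?thesis by blast
qed

end

section \<open>Contraction of tensor products\<close>

lemma linear_eq_on_tensors:
  assumes T: "tensor_product I s sT \<tau>"
    and "Vector_Spaces.linear sT sX f" "Vector_Spaces.linear sT sX g" "\<And>u. f (\<tau> u) = g (\<tau> u)"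
  shows "f x = g x"
proof -
  interpret vector_space_pair sT sX
    using assms(2) by (simp add: Vector_Spaces.linear_def vector_space_pair_def)
  show ?thesis
    using assms tensor_product_span[OF T]
    by (intro linear_eq_on[of f g x "range \<tau>"]) auto
qed

lemma multilinear_cong: "multilinear I s sX f \<Longrightarrow> (\<And>i. i \<in> I \<Longrightarrow> w i = w' i) \<Longrightarrow> f w = f w'"
  by (auto simp: multilinear_def)

lemma multilinear_prod:
  assumes "finite I" "\<And>i. i \<in> I \<Longrightarrow> Vector_Spaces.linear (s i) (*) (f i)"
  shows "multilinear I s (*) (\<lambda>u. \<Prod>i\<in>I. f i (u i) :: complex)"
  unfolding multilinear_def
proof (intro conjI allI impI ballI)
  fix i u assume i: "i \<in> I"
  interpret vector_space "s i"
    using assms(2)[OF i] by (simp add: Vector_Spaces.linear_def)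
  interpret C: vector_space "(*) :: complex \<Rightarrow> complex \<Rightarrow> complex" by (rule vector_space_complex)
  interpret vector_space_pair "s i" "(*) :: complex \<Rightarrow> complex \<Rightarrow> complex" ..
  have "(\<Prod>j\<in>I. f j ((u(i := x)) j)) = (\<Prod>j\<in>I - {i}. f j (u j)) * f i x" for x
    using assms(1) i by (simp add: prod.remove[of I i] mult.commute)
  then show "Vector_Spaces.linear (s i) (*) (\<lambda>x. \<Prod>j\<in>I. f j ((u(i := x)) j))"
    using linear_compose_scale_right[OF assms(2)[OF i]] by simp
qed (auto intro!: prod.cong)

text \<open>Slot \<open>i\<close> enters only through the scalar and the other slots only through
  \<open>\<tau>\<close>. The universal property turns this map into the operator that evaluates slot
  \<open>i\<close> by \<open>f\<close> and refills it with \<open>b\<close>.\<close>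

lemma multilinear_contract:
  assumes m: "multilinear I s sX \<tau>" and i: "i \<in> I"
    and f: "Vector_Spaces.linear (s i) (*) f"
  shows "multilinear I s sX (\<lambda>u. sX (f (u i)) (\<tau> (u(i := b))))"
  unfolding multilinear_def
proof (intro conjI allI impI ballI)
  fix u u' :: "'a \<Rightarrow> 'b" assume "\<forall>j\<in>I. u j = u' j"
  then show "sX (f (u i)) (\<tau> (u(i := b))) = sX (f (u' i)) (\<tau> (u'(i := b)))"
    using i by (simp add: multilinear_cong[OF m, of "u(i := b)" "u'(i := b)"])
next
  fix j u assume j: "j \<in> I"
  have lin: "Vector_Spaces.linear (s j) sX (\<lambda>x. \<tau> (w(j := x)))" for w
    using m j by (simp add: multilinear_def)
  interpret X: vector_space sX using lin by (simp add: Vector_Spaces.linear_def)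
  interpret J: vector_space "s j" using lin by (simp add: Vector_Spaces.linear_def)
  interpret vector_space_pair "s j" sX ..
  show "Vector_Spaces.linear (s j) sX (\<lambda>x. sX (f ((u(j := x)) i)) (\<tau> ((u(j := x))(i := b))))"
  proof (cases "j = i")
    case True
    interpret f: Vector_Spaces.linear "s i" "(*)" f by fact
    show ?thesis
      using X.vector_space_axioms J.vector_space_axioms
      by (simp add: True Vector_Spaces.linear_iff f.add f.scale X.scale_left_distrib)
  next
    case False
    then show ?thesis
      using linear_compose_scale_right[OF lin[of "u(i := b)"]] by (simp add: fun_upd_twist)
  qed
qed

text \<open>Dual to the contraction: the functional evaluates all slots except the
  \<open>i\<close>-th, where \<open>b\<close> is a placeholder, and the entry \<open>u i\<close> is
  kept. This moves a question about a tensor into a single factor.\<close>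

lemma multilinear_slot:
  assumes m: "multilinear I s sX \<tau>" and i: "i \<in> I"
    and f: "Vector_Spaces.linear sX (*) f" and v: "vector_space (s i)"
  shows "multilinear I s (s i) (\<lambda>u. s i (f (\<tau> (u(i := b)))) (u i))"
  unfolding multilinear_def
proof (intro conjI allI impI ballI)
  fix u u' :: "'a \<Rightarrow> 'b" assume "\<forall>j\<in>I. u j = u' j"
  then show "s i (f (\<tau> (u(i := b)))) (u i) = s i (f (\<tau> (u'(i := b)))) (u' i)"
    using i by (simp add: multilinear_cong[OF m, of "u(i := b)" "u'(i := b)"])
next
  fix j u assume j: "j \<in> I"
  have lin: "Vector_Spaces.linear (s j) sX (\<lambda>x. \<tau> (w(j := x)))" for w
    using m j by (simp add: multilinear_def)
  interpret I: vector_space "s i" by fact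
  interpret J: vector_space "s j" using lin by (simp add: Vector_Spaces.linear_def)
  have lin: "Vector_Spaces.linear (s j) (*) (\<lambda>x. f (\<tau> (w(j := x))))" for w
    using Vector_Spaces.linear_compose[OF lin f] by (simp add: o_def)
  interpret vector_space_pair "s j" "s i" ..
  show "Vector_Spaces.linear (s j) (s i) (\<lambda>x. s i (f (\<tau> ((u(j := x))(i := b)))) ((u(j := x)) i))"
  proof (cases "j = i")
    case True
    then show ?thesis using I.linear_scale_self by simp
  next
    case False
    interpret g: Vector_Spaces.linear "s j" "(*)" "\<lambda>x. f (\<tau> ((u(i := b))(j := x)))" by (rule lin)
    have "u(j := y, i := b) = u(i := b, j := y)" for y using False by (rule fun_upd_twist)
    then show ?thesis using False I.vector_space_axioms J.vector_space_axioms g.add g.scale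
      by (simp add: Vector_Spaces.linear_iff I.scale_left_distrib)
  qed
qed

lemma contraction_exists:
  assumes T: "tensor_product I s sT \<tau>" and i: "i \<in> I"
    and f: "Vector_Spaces.linear (s i) (*) f"
  shows "\<exists>E. Vector_Spaces.linear sT sT E \<and> (\<forall>u. E (\<tau> u) = sT (f (u i)) (\<tau> (u(i := b))))"
proof -
  have m: "multilinear I s sT \<tau>" "vector_space sT"
    using T by (auto simp: tensor_product_def)
  have "multilinear I s sT (\<lambda>u. sT (f (u i)) (\<tau> (u(i := b))))"
    by (rule multilinear_contract) fact+
  from tensor_product_universal[OF T this m(2)] show ?thesis by metis
qed

text \<open>
  If \<open>E\<^sub>f\<^sub>,\<^sub>b\<close> contracts the \<open>i\<close>-th slot by \<open>f\<close> and inserts \<open>b\<close>, then for a functional \<open>\<phi>\<close> the vector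
  in the \<open>i\<close>-th factor obtained from \<open>x\<close> by applying \<open>\<phi>\<close> to the other slots is sent by \<open>f\<close> to \<open>\<phi> (E\<^sub>f\<^sub>,\<^sub>b x)\<close>.
  So if all \<open>E\<^sub>f\<^sub>,\<^sub>b x\<close> with \<open>f \<in> F\<close> vanish, they vanish for coordinate functionals \<open>f\<close>, and these recover
  \<open>x\<close>.
\<close>

lemma contraction_nonzero:
  assumes T: "tensor_product I s sT \<tau>" and i: "i \<in> I"
    and F: "\<And>f. f \<in> F \<Longrightarrow> Vector_Spaces.linear (s i) (*) f"
      "\<And>y. (\<And>f. f \<in> F \<Longrightarrow> f y = 0) \<Longrightarrow> y = 0"
    and x: "x \<noteq> 0"
  shows "\<exists>f\<in>F. \<exists>b E. Vector_Spaces.linear sT sT E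
    \<and> (\<forall>u. E (\<tau> u) = sT (f (u i)) (\<tau> (u(i := b)))) \<and> E x \<noteq> 0"
proof (rule ccontr)
  assume neg: "\<not> ?thesis"
  interpret T: vector_space sT using T by (simp add: tensor_product_def)
  interpret W: vector_space "s i" using T i by (simp add: tensor_product_def)
  interpret C: vector_space "(*) :: complex \<Rightarrow> complex \<Rightarrow> complex" by (rule vector_space_complex)
  interpret WC: vector_space_pair "s i" "(*) :: complex \<Rightarrow> complex \<Rightarrow> complex" ..
  interpret TT: vector_space_pair sT sT ..
  have m: "multilinear I s sT \<tau>" using T by (simp add: tensor_product_def)
  obtain \<phi> where \<phi>: "Vector_Spaces.linear sT (*) \<phi>" "\<phi> x = (1::complex)"
    using functional_separates[OF T.vector_space_axioms, of x "{}"] x by auto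
  interpret \<phi>: Vector_Spaces.linear sT "(*)" \<phi> by (rule \<phi>(1))
  obtain E where E: "\<And>f b. Vector_Spaces.linear (s i) (*) f \<Longrightarrow>
      Vector_Spaces.linear sT sT (E f b) \<and> (\<forall>u. E f b (\<tau> u) = sT (f (u i)) (\<tau> (u(i := b))))"
    using contraction_exists[OF T i] by metis
  have zero: "\<phi> (E f b x) = 0" if f: "Vector_Spaces.linear (s i) (*) f" for f b
  proof -
    obtain g where g: "Vector_Spaces.linear sT (s i) g"
        "\<And>u. s i (\<phi> (\<tau> (u(i := b)))) (u i) = g (\<tau> u)"
      using tensor_product_universal[OF T multilinear_slot[OF m i \<phi>(1) W.vector_space_axioms]
          W.vector_space_axioms] by metis
    have eq: "k (g y) = \<phi> (E k b y)" if k: "Vector_Spaces.linear (s i) (*) k" for k y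
    proof (rule linear_eq_on_tensors[OF T, where x = y])
      show "Vector_Spaces.linear sT (*) (\<lambda>y. k (g y))"
        using Vector_Spaces.linear_compose[OF g(1) k] by (simp add: o_def)
      show "Vector_Spaces.linear sT (*) (\<lambda>y. \<phi> (E k b y))"
        using Vector_Spaces.linear_compose[of sT sT "E k b" "(*)" \<phi>] E[OF k] \<phi>(1) by (simp add: o_def)
      interpret k: Vector_Spaces.linear "s i" "(*)" k by (rule k)
      show "k (g (\<tau> u)) = \<phi> (E k b (\<tau> u))" for u
        using E[OF k, of b] by (simp add: g(2)[symmetric] k.scale \<phi>.scale)
    qed
    have "g x = 0"
    proof (rule F(2))
      fix k assume k: "k \<in> F"
      then have "E k b x = 0" using neg E[OF F(1)[OF k], of b] by blast
      then show "k (g x) = 0" using eq[OF F(1)[OF k]] by (simp add: \<phi>.zero)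
    qed
    then show ?thesis using eq[OF f, of x] WC.linear_0[OF f] by simp
  qed
  define B where "B = W.extend_basis {}"
  have B: "W.independent B" "W.span B = UNIV"
    using W.independent_extend_basis[of "{}"] W.span_extend_basis[of "{}"]
    by (simp_all add: B_def W.independent_empty)
  define c where "c = (\<lambda>b y. W.representation B y b)"
  have c: "Vector_Spaces.linear (s i) (*) (c b)" for b
    unfolding c_def
    using W.vector_space_axioms C.vector_space_axioms
    by (simp add: Vector_Spaces.linear_iff B W.representation_add W.representation_scale)
  obtain U where U: "finite U" "x \<in> T.span (\<tau> ` U)"
  proof -
    have "x \<in> T.span (range \<tau>)" using tensor_product_span[OF T] by simp
    then obtain S where "finite S" "S \<subseteq> range \<tau>" "x \<in> T.span S"
      by (auto simp: T.span_explicit intro: T.span_sum T.span_scale T.span_base)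
    moreover from this obtain U where "finite U" "S = \<tau> ` U" by (meson finite_subset_image)
    ultimately show ?thesis using that by blast
  qed
  \<comment> \<open>The basis vectors occurring in the \<open>i\<close>-th entries of finitely many
    tensors whose span contains \<open>x\<close>; they make the expansion below a finite
    sum.\<close>
  define B0 where "B0 = (\<Union>u\<in>U. {b. c b (u i) \<noteq> 0})"
  have B0: "finite B0" using U(1) by (simp add: B0_def c_def W.finite_representation)
  \<comment> \<open>Contracting by each coordinate functional and reinserting the corresponding
    basis vector recovers every tensor from \<open>U\<close>, by expanding its \<open>i\<close>-th
    entry.\<close>
  have "x = (\<Sum>b\<in>B0. E (c b) b x)"
  proof (rule TT.linear_eq_on[of "\<lambda>x. x" _ _ "\<tau> ` U"])
    show "Vector_Spaces.linear sT sT (\<lambda>x. x)" by (rule T.linear_ident)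
    show "Vector_Spaces.linear sT sT (\<lambda>x. \<Sum>b\<in>B0. E (c b) b x)"
      using E[OF c] by (intro TT.linear_compose_sum) blast
    fix y assume "y \<in> \<tau> ` U"
    then obtain u where u: "u \<in> U" "y = \<tau> u" by blast
    interpret t: Vector_Spaces.linear "s i" sT "\<lambda>x. \<tau> (u(i := x))"
      using m i by (simp add: multilinear_def)
    have "u i = (\<Sum>b\<in>{b. c b (u i) \<noteq> 0}. s i (c b (u i)) b)"
      using W.sum_nonzero_representation_eq[of B "u i"] B by (simp add: c_def)
    also have "\<dots> = (\<Sum>b\<in>B0. s i (c b (u i)) b)"
      using B0 u(1) by (intro sum.mono_neutral_left) (auto simp: B0_def)
    finally have "\<tau> (u(i := u i)) = \<tau> (u(i := \<Sum>b\<in>B0. s i (c b (u i)) b))" by simp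
    also have "\<dots> = (\<Sum>b\<in>B0. sT (c b (u i)) (\<tau> (u(i := b))))"
      by (simp add: t.sum t.scale)
    finally have "y = (\<Sum>b\<in>B0. sT (c b (u i)) (\<tau> (u(i := b))))" by (simp add: u(2))
    moreover have "(\<Sum>b\<in>B0. E (c b) b y) = (\<Sum>b\<in>B0. sT (c b (u i)) (\<tau> (u(i := b))))"
      using E[OF c] by (simp add: u(2))
    ultimately show "y = (\<Sum>b\<in>B0. E (c b) b y)" by (rule trans[OF _ sym])
  qed (use U(2) in auto)
  then have "\<phi> x = \<phi> (\<Sum>b\<in>B0. E (c b) b x)" by (rule arg_cong)
  then show False using zero[OF c] \<phi>(2) by (simp only: \<phi>.sum) simp
qed

text \<open>The slots are contracted one at a time by \<open>contraction_nonzero\<close>, keeping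
  the image of \<open>x\<close> nonzero. After the last slot the image is a multiple of one fixed
  tensor, with \<open>g x\<close> as the scalar.\<close>

lemma tensor_product_separating:
  assumes T: "tensor_product I s sT \<tau>" and I: "finite I"
    and F: "\<And>i f. i \<in> I \<Longrightarrow> f \<in> F i \<Longrightarrow> Vector_Spaces.linear (s i) (*) f"
      "\<And>i y. i \<in> I \<Longrightarrow> (\<And>f. f \<in> F i \<Longrightarrow> f y = 0) \<Longrightarrow> y = 0"
    and x: "x \<noteq> 0"
  shows "\<exists>f. (\<forall>i\<in>I. f i \<in> F i) \<and> (\<forall>g. Vector_Spaces.linear sT (*) g \<longrightarrow>
    (\<forall>u. g (\<tau> u) = (\<Prod>i\<in>I. f i (u i))) \<longrightarrow> g x \<noteq> 0)"
proof -
  interpret T: vector_space sT using T by (simp add: tensor_product_def)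
  have "\<exists>f c D. (\<forall>i\<in>J. f i \<in> F i) \<and> Vector_Spaces.linear sT sT D \<and>
      (\<forall>u. D (\<tau> u) = sT (\<Prod>i\<in>J. f i (u i)) (\<tau> (\<lambda>i. if i \<in> J then c i else u i))) \<and> D x \<noteq> 0"
    if "finite J" "J \<subseteq> I" for J
    using that
  proof (induction J rule: finite_induct)
    case empty
    show ?case using x T.linear_ident
      by (intro exI[of _ "\<lambda>_ _. 0"] exI[of _ undefined] exI[of _ "\<lambda>x. x"]) simp
  next
    case (insert j J)
    then obtain f c D where D: "\<forall>i\<in>J. f i \<in> F i" "Vector_Spaces.linear sT sT D"
      "\<And>u. D (\<tau> u) = sT (\<Prod>i\<in>J. f i (u i)) (\<tau> (\<lambda>i. if i \<in> J then c i else u i))" "D x \<noteq> 0"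
      by auto
    have j: "j \<in> I" using insert.prems by simp
    obtain k b E where k: "k \<in> F j" and E: "Vector_Spaces.linear sT sT E"
        "\<And>u. E (\<tau> u) = sT (k (u j)) (\<tau> (u(j := b)))" "E (D x) \<noteq> 0"
      using contraction_nonzero[OF T j F(1)[OF j] F(2)[OF j] D(4)] by metis
    interpret E: Vector_Spaces.linear sT sT E by (rule E(1))
    have "Vector_Spaces.linear sT sT (\<lambda>x. E (D x))"
      using Vector_Spaces.linear_compose[OF D(2) E(1)] by (simp add: o_def)
    moreover have "E (D (\<tau> u)) = sT (\<Prod>i\<in>insert j J. (f(j := k)) i (u i))
        (\<tau> (\<lambda>i. if i \<in> insert j J then (c(j := b)) i else u i))" for u
    proof -
      have "(\<lambda>i. if i \<in> J then c i else u i)(j := b)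
          = (\<lambda>i. if i \<in> insert j J then (c(j := b)) i else u i)"
        by (auto simp: fun_eq_iff)
      moreover have "(\<Prod>i\<in>J. (f(j := k)) i (u i)) = (\<Prod>i\<in>J. f i (u i))"
        using insert.hyps by (intro prod.cong) auto
      ultimately show ?thesis
        using insert.hyps by (simp add: D(3) E.scale E(2) mult.commute)
    qed
    ultimately show ?case
      using D(1) k insert.hyps E(3)
      by (intro exI[of _ "f(j := k)"] exI[of _ "c(j := b)"] exI[of _ "\<lambda>x. E (D x)"]) auto
  qed
  from this[OF I order_refl] obtain f c D where D: "\<forall>i\<in>I. f i \<in> F i" "Vector_Spaces.linear sT sT D"
      "\<And>u. D (\<tau> u) = sT (\<Prod>i\<in>I. f i (u i)) (\<tau> (\<lambda>i. if i \<in> I then c i else u i))" "D x \<noteq> 0"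
    by blast
  have "g x \<noteq> 0" if g: "Vector_Spaces.linear sT (*) g" "\<And>u. g (\<tau> u) = (\<Prod>i\<in>I. f i (u i))" for g
  proof -
    have "D x = sT (g x) (\<tau> c)"
    proof (rule linear_eq_on_tensors[OF T D(2)])
      interpret g: Vector_Spaces.linear sT "(*)" g by (rule g(1))
      show "Vector_Spaces.linear sT sT (\<lambda>x. sT (g x) (\<tau> c))"
        using T.vector_space_axioms
        by (simp add: Vector_Spaces.linear_iff g.add g.scale T.scale_left_distrib)
      have "\<tau> (\<lambda>i. if i \<in> I then c i else u i) = \<tau> c" for u
        using T by (intro multilinear_cong[of I s sT \<tau>]) (auto simp: tensor_product_def)
      then show "D (\<tau> u) = sT (g (\<tau> u)) (\<tau> c)" for u
        by (simp add: D(3) g(2))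
    qed
    then show ?thesis using D(4) by auto
  qed
  then show ?thesis using D(1) by blast
qed

section \<open>Irreducible lowest weight modules\<close>

text \<open>This is the relation \<open>[L(0), L(n)] = -n L(n)\<close>.\<close>

lemma virasoro_rep_weight_space:
  assumes "virasoro_rep s c L" "x \<in> weight_space s L h"
  shows "L n x \<in> weight_space s L (h - of_int n)"
proof -
  interpret vector_space s using assms(1) by (simp add: virasoro_rep_def)
  interpret n: Vector_Spaces.linear s s "L n" using assms(1) by (simp add: virasoro_rep_def)
  have "L 0 (L n x) - L n (L 0 x) = s (of_int (- n)) (L n x)"
    using assms(1) by (simp add: virasoro_rep_def)
  then have "L 0 (L n x) = s (of_int (- n)) (L n x) + s h (L n x)"
    using assms(2) by (simp add: weight_space_def n.scale diff_eq_eq)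
  then have "L 0 (L n x) = s (h - of_int n) (L n x)"
    by (simp add: scale_left_diff_distrib)
  then show ?thesis by (simp add: weight_space_def)
qed

context
  fixes s :: "complex \<Rightarrow> 'w::ab_group_add \<Rightarrow> 'w" and L c h v
  assumes irr: "irreducible_virasoro_lowest_weight s L c h"
    and v: "weight_space s L h = module.span s {v}"
begin

interpretation vector_space s
  using irr by (simp add: irreducible_virasoro_lowest_weight_def virasoro_rep_def)

interpretation complex_space s ..

lemma virasoro_linear: "Vector_Spaces.linear s s (L n)"
  using irr by (simp add: irreducible_virasoro_lowest_weight_def virasoro_rep_def)

interpretation L: Vector_Spaces.linear s s "L n" for n
  by (rule virasoro_linear)

lemma lowest_weight_vector_exists:
  obtains a where "lowest_weight_vector s L h (s a v)" "virasoro_subrep s L hull {s a v} = UNIV"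
proof -
  obtain w where w: "lowest_weight_vector s L h w" "virasoro_subrep s L hull {w} = UNIV"
    using irr by (auto simp: irreducible_virasoro_lowest_weight_def)
  then have "w \<in> weight_space s L h" by (simp add: lowest_weight_vector_def weight_space_def)
  then obtain a where "w = s a v" unfolding v by (auto simp: span_singleton)
  then show ?thesis using w by (intro that[of a]) simp_all
qed

text \<open>The definition of irreducibility provides only some generating lowest weight vector. The
  weight space of \<open>h\<close> is the line through \<open>v\<close>, so that vector is a nonzero
  multiple of \<open>v\<close>.\<close>

lemma lowest_weight_generator:
  shows "lowest_weight_vector s L h v"
    and "virasoro_subrep s L U \<Longrightarrow> v \<in> U \<Longrightarrow> U = UNIV"
proof -
  obtain a where a: "lowest_weight_vector s L h (s a v)"
    "virasoro_subrep s L hull {s a v} = UNIV" by (rule lowest_weight_vector_exists)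
  have "s a (L 0 v) = s a (s h v)"
    using a(1) by (simp only: lowest_weight_vector_def L.scale scale_left_commute[of a h])
  moreover have "a \<noteq> 0" using a(1) by (auto simp: lowest_weight_vector_def)
  ultimately have "L 0 v = s h v" by (rule scale_left_imp_eq[rotated])
  then show "lowest_weight_vector s L h v"
    using a(1) by (auto simp: lowest_weight_vector_def L.scale)
  assume U: "virasoro_subrep s L U" "v \<in> U"
  then have "s a v \<in> U" by (simp add: virasoro_subrep_def subspace_scale)
  then have "virasoro_subrep s L hull {s a v} \<subseteq> U" by (intro hull_minimal) (auto intro: U)
  then show "U = UNIV" using a(2) by blast
qed

text \<open>The subspace \<open>D\<close> generated from \<open>v\<close> by lowering operators
  alone turns out to be a subrepresentation, by the commutation relations.\<close>

lemma lowering_operators_generate: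
  assumes "subspace U" "v \<in> U" "\<And>k x. k > 0 \<Longrightarrow> x \<in> U \<Longrightarrow> L (- k) x \<in> U"
  shows "U = UNIV"
proof -
  define P where "P = (\<lambda>A. subspace A \<and> (\<forall>k>0. \<forall>x\<in>A. L (- k) x \<in> A))"
  define D where "D = P hull {v}"
  have "P D" unfolding D_def
    by (rule hull_in) (auto simp: P_def intro: subspace_Inter)
  then have D: "subspace D" "\<And>k x. k > 0 \<Longrightarrow> x \<in> D \<Longrightarrow> L (- k) x \<in> D"
    by (auto simp: P_def)
  have vD: "v \<in> D" unfolding D_def using hull_subset[of "{v}" P] by blast
  \<comment> \<open>\<open>E\<close> collects the vectors of \<open>D\<close> that every mode maps
    back into \<open>D\<close>. Commuting \<open>L m\<close> past a lowering operator shows that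
    \<open>E\<close> is closed under lowering; it contains \<open>v\<close>, so minimality of
    \<open>D\<close> gives \<open>D = E\<close>.\<close>
  define E where "E = {x \<in> D. \<forall>m. L m x \<in> D}"
  have "P E"
    unfolding P_def
  proof (intro conjI allI impI ballI)
    show "subspace E" unfolding subspace_def E_def
      using D(1) by (auto simp: L.add L.scale L.zero subspace_add subspace_scale subspace_0)
    fix k :: int and x assume k: "k > 0" "x \<in> E"
    have "L m (L (- k) x) - L (- k) (L m x) = s (of_int (m - - k)) (L (m + - k) x) +
        (if m + - k = 0 then s (of_int (m ^ 3 - m) / 12 * c) x else 0)" for m
      using irr unfolding irreducible_virasoro_lowest_weight_def virasoro_rep_def by blast
    then have "L m (L (- k) x) = L (- k) (L m x) + (s (of_int (m - - k)) (L (m + - k) x) +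
        (if m + - k = 0 then s (of_int (m ^ 3 - m) / 12 * c) x else 0))" for m
      by (subst add.commute) (simp add: diff_eq_eq)
    then have "L m (L (- k) x) \<in> D" for m
      using k D by (auto simp: E_def intro!: subspace_add subspace_scale subspace_0)
    then show "L (- k) x \<in> E" using k D by (simp add: E_def)
  qed
  moreover have "v \<in> E"
  proof -
    have "L m v \<in> D" for m
      using lowest_weight_generator(1) vD D(2)[of "- m" v] D(1)
      by (cases m "0 :: int" rule: linorder_cases)
        (auto simp: lowest_weight_vector_def subspace_scale subspace_0)
    then show ?thesis using vD by (simp add: E_def)
  qed
  ultimately have "D \<subseteq> E" unfolding D_def by (intro hull_minimal) auto
  then have "virasoro_subrep s L D" using D(1) by (auto simp: virasoro_subrep_def E_def)
  then have "D = UNIV" using lowest_weight_generator(2) vD by blast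
  moreover have "D \<subseteq> U" unfolding D_def using assms by (intro hull_minimal) (auto simp: P_def)
  ultimately show ?thesis by blast
qed

text \<open>The sum \<open>K\<close> of the weight spaces of weight \<open>h + n\<close>,
  \<open>n > 0\<close>, contains the image of every lowering operator but not \<open>v\<close>. The
  functional is chosen to be \<open>1\<close> at \<open>v\<close> and \<open>0\<close> on
  \<open>K\<close>.\<close>

lemma lowest_weight_functional:
  "\<exists>\<xi>. Vector_Spaces.linear s (*) \<xi> \<and> \<xi> v = 1 \<and> (\<forall>k>0. \<forall>x. \<xi> (L (- k) x) = 0)"
proof -
  define K where "K = span (\<Union>\<mu>\<in>{h + of_int n | n. n > 0}. weight_space s L \<mu>)"
  have rep: "virasoro_rep s c L"
    using irr by (simp add: irreducible_virasoro_lowest_weight_def)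
  have vh: "v \<in> weight_space s L h"
    using lowest_weight_generator(1) by (simp add: lowest_weight_vector_def weight_space_def)
  have low: "L (- k) x \<in> K" if "k > 0" "x \<in> weight_space s L (h + of_int n)" "n \<ge> 0" for k n x
  proof -
    have "L (- k) x \<in> weight_space s L (h + of_int (n + k))"
      using virasoro_rep_weight_space[OF rep that(2), of "- k"] by (simp add: add.assoc)
    moreover have "h + of_int (n + k) \<in> {h + of_int n | n. n > 0}"
      using that by (intro CollectI exI[of _ "n + k"]) auto
    ultimately show ?thesis unfolding K_def by (intro span_base) blast
  qed
  have lowK: "L (- k) x \<in> K" if "k > 0" "x \<in> K" for k x
  proof -
    have "L (- k) ` (\<Union>\<mu>\<in>{h + of_int n | n. n > 0}. weight_space s L \<mu>) \<subseteq> K"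
      using low[OF that(1)] by fastforce
    then have "span (L (- k) ` (\<Union>\<mu>\<in>{h + of_int n | n. n > 0}. weight_space s L \<mu>)) \<subseteq> K"
      unfolding K_def by (rule span_minimal[OF _ subspace_span])
    then show ?thesis
      using that(2) unfolding K_def L.span_image by blast
  qed
  have lowv: "L (- k) v \<in> K" if "k > 0" for k
    using low[OF that, of v 0] vh by simp
  have K: "subspace K" unfolding K_def by (rule subspace_span)
  \<comment> \<open>The module is the line through \<open>v\<close> plus \<open>K\<close>: this sum
    contains \<open>v\<close>, and lowering operators map it into \<open>K\<close>.\<close>
  have "{x. \<exists>a. x - s a v \<in> K} = UNIV"
  proof (rule lowering_operators_generate)
    show "subspace {x. \<exists>a. x - s a v \<in> K}"
      unfolding subspace_def
    proof safe
      show "\<exists>a. 0 - s a v \<in> K" using subspace_0[OF K] by (intro exI[of _ 0]) simp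
    next
      fix x y a b assume "x - s a v \<in> K" "y - s b v \<in> K"
      then show "\<exists>a. x + y - s a v \<in> K"
        using subspace_add[OF K, of "x - s a v" "y - s b v"]
        by (intro exI[of _ "a + b"]) (simp add: scale_left_distrib algebra_simps)
    next
      fix r x a assume "x - s a v \<in> K"
      then show "\<exists>a. s r x - s a v \<in> K"
        using subspace_scale[OF K, of "x - s a v" r]
        by (intro exI[of _ "r * a"]) (simp add: scale_right_diff_distrib)
    qed
    show "v \<in> {x. \<exists>a. x - s a v \<in> K}"
      using subspace_0[OF K] by (auto intro!: exI[of _ 1])
    fix k :: int and x assume k: "k > 0" "x \<in> {x. \<exists>a. x - s a v \<in> K}"
    then obtain a where "x - s a v \<in> K" by blast
    then have "L (- k) (x - s a v) + s a (L (- k) v) \<in> K"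
      using lowK[OF k(1)] lowv[OF k(1)] K by (intro subspace_add subspace_scale)
    then show "L (- k) x \<in> {x. \<exists>a. x - s a v \<in> K}"
      by (auto simp: L.diff L.scale intro!: exI[of _ 0])
  qed
  then have image: "L (- k) x \<in> K" if "k > 0" for k x
  proof -
    obtain a where "x - s a v \<in> K" using \<open>_ = UNIV\<close> by blast
    then have "L (- k) (x - s a v) + s a (L (- k) v) \<in> K"
      using lowK[OF that] lowv[OF that] K by (intro subspace_add subspace_scale)
    then show ?thesis by (simp add: L.diff L.scale)
  qed
  have "v \<notin> K"
  proof
    assume "v \<in> K"
    then have "v = 0"
      using weight_space_inter_span[where L = L and h = h and x = v
          and H = "{h + of_int n | n. n > 0}"] virasoro_linear vh
      unfolding K_def by auto
    then show False using lowest_weight_generator(1) by (simp add: lowest_weight_vector_def)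
  qed
  then obtain \<xi> where "Vector_Spaces.linear s (*) \<xi>" "\<xi> v = 1" "\<forall>y\<in>K. \<xi> y = 0"
    unfolding K_def using functional_separates[OF vector_space_axioms] by blast
  then show ?thesis using image by blast
qed

text \<open>The vectors on which all words of modes followed by \<open>\<xi>\<close> vanish form a
  subrepresentation missing \<open>v\<close>, so irreducibility makes it zero.\<close>

lemma lowest_weight_functional_separates:
  assumes \<xi>: "Vector_Spaces.linear s (*) \<xi>" "\<xi> v = 1"
    and y: "\<And>ms. \<xi> (foldr L ms y) = 0"
  shows "y = 0"
proof -
  interpret \<xi>: Vector_Spaces.linear s "(*)" \<xi> by (rule \<xi>(1))
  define U where "U = {y. \<forall>ms. \<xi> (foldr L ms y) = 0}"
  have fold: "foldr L ms 0 = 0" "foldr L ms (x + y) = foldr L ms x + foldr L ms y"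
    "foldr L ms (s a x) = s a (foldr L ms x)" for ms x y a
    by (induction ms) (simp_all add: L.zero L.add L.scale)
  have "virasoro_subrep s L U"
    unfolding virasoro_subrep_def subspace_def
  proof (intro conjI allI ballI)
    fix n w assume w: "w \<in> U"
    \<comment> \<open>\<open>foldr\<close> applies the last list entry first, so a word applied to
      \<open>L n w\<close> is the word with \<open>n\<close> appended applied to
      \<open>w\<close>.\<close>
    have "\<xi> (foldr L (ms @ [n]) w) = 0" for ms using w by (simp add: U_def del: foldr_append)
    then show "L n w \<in> U" by (simp add: U_def)
  qed (simp_all add: U_def fold \<xi>.zero \<xi>.add \<xi>.scale)
  then have "U = {0} \<or> U = UNIV"
    using irr by (simp add: irreducible_virasoro_lowest_weight_def)
  moreover have "v \<notin> U"
    unfolding U_def using \<xi>(2) by (auto intro!: exI[of _ "[]"])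
  ultimately show ?thesis using y by (auto simp: U_def)
qed

end

section \<open>Tensor products of lowest weight modules\<close>

text \<open>\<open>X i m\<close> is the Virasoro mode of the \<open>i\<close>-th factor acting on
  the tensor product. The structure of the module is studied through these slot operators alone;
  vertex operators return at the end.\<close>

locale virasoro_tensor =
  fixes I :: "'i set" and s :: "'i \<Rightarrow> complex \<Rightarrow> 'w::ab_group_add \<Rightarrow> 'w"
    and sX :: "complex \<Rightarrow> 'x::ab_group_add \<Rightarrow> 'x" and \<tau> :: "('i \<Rightarrow> 'w) \<Rightarrow> 'x"
    and L :: "'i \<Rightarrow> int \<Rightarrow> 'w \<Rightarrow> 'w" and c :: complex and h :: "'i \<Rightarrow> complex"
    and v :: "'i \<Rightarrow> 'w" and X :: "'i \<Rightarrow> int \<Rightarrow> 'x \<Rightarrow> 'x"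
  assumes finite_I: "finite I" and tensor: "tensor_product I s sX \<tau>"
    and irr: "\<And>i. i \<in> I \<Longrightarrow> irreducible_virasoro_lowest_weight (s i) (L i) c (h i)"
    and lowest: "\<And>i. i \<in> I \<Longrightarrow> weight_space (s i) (L i) (h i) = module.span (s i) {v i}"
    and X_linear: "\<And>i m. i \<in> I \<Longrightarrow> Vector_Spaces.linear sX sX (X i m)"
    and X_tensor: "\<And>i m w. i \<in> I \<Longrightarrow> X i m (\<tau> w) = \<tau> (w(i := L i m (w i)))"
begin

sublocale complex_space sX
  using tensor by (simp add: tensor_product_def complex_space_def)

lemma slot_linear: "i \<in> I \<Longrightarrow> Vector_Spaces.linear (s i) sX (\<lambda>x. \<tau> (w(i := x)))"
  using tensor by (simp add: tensor_product_def multilinear_def)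

lemma X_commutator:
  assumes i: "i \<in> I" and j: "j \<in> I"
  shows "X i m (X j n x) - X j n (X i m x) =
    (if i = j then sX (of_int (m - n)) (X i (m + n) x) +
        (if m + n = 0 then sX (of_int (m ^ 3 - m) / 12 * c) x else 0) else 0)"
proof (rule linear_eq_on_tensors[OF tensor, where x = x])
  interpret vector_space_pair sX sX ..
  show "Vector_Spaces.linear sX sX (\<lambda>x. X i m (X j n x) - X j n (X i m x))"
    using Vector_Spaces.linear_compose[OF X_linear[OF i] X_linear[OF j]]
      Vector_Spaces.linear_compose[OF X_linear[OF j] X_linear[OF i]]
    by (intro linear_compose_sub) (simp_all add: o_def)
  show "Vector_Spaces.linear sX sX (\<lambda>x. if i = j then sX (of_int (m - n)) (X i (m + n) x) +
        (if m + n = 0 then sX (of_int (m ^ 3 - m) / 12 * c) x else 0) else 0)"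
    by (cases "i = j"; cases "m + n = 0")
      (auto intro!: linear_zero linear_compose_add linear_scale_self
        linear_compose_scale_right[OF X_linear[OF j]])
  fix u
  show "X i m (X j n (\<tau> u)) - X j n (X i m (\<tau> u)) =
    (if i = j then sX (of_int (m - n)) (X i (m + n) (\<tau> u)) +
        (if m + n = 0 then sX (of_int (m ^ 3 - m) / 12 * c) (\<tau> u) else 0) else 0)"
  proof (cases "i = j")
    case False
    then show ?thesis using i j by (simp add: X_tensor fun_upd_twist)
  next
    case True
    interpret t: Vector_Spaces.linear "s i" sX "\<lambda>x. \<tau> (u(i := x))" by (rule slot_linear[OF i])
    have "L i m (L i n (u i)) - L i n (L i m (u i)) =
        s i (of_int (m - n)) (L i (m + n) (u i)) +
        (if m + n = 0 then s i (of_int (m ^ 3 - m) / 12 * c) (u i) else 0)"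
      using irr[OF i] unfolding irreducible_virasoro_lowest_weight_def virasoro_rep_def by blast
    then have "\<tau> (u(i := L i m (L i n (u i)))) - \<tau> (u(i := L i n (L i m (u i)))) =
        \<tau> (u(i := s i (of_int (m - n)) (L i (m + n) (u i)) +
        (if m + n = 0 then s i (of_int (m ^ 3 - m) / 12 * c) (u i) else 0)))"
      by (simp only: flip: t.diff)
    also have "\<dots> = sX (of_int (m - n)) (\<tau> (u(i := L i (m + n) (u i)))) +
        (if m + n = 0 then sX (of_int (m ^ 3 - m) / 12 * c) (\<tau> (u(i := u i))) else 0)"
      by (cases "m + n = 0") (simp_all only: t.add t.scale if_True if_False t.zero refl)
    finally show ?thesis using i by (simp add: True[symmetric] X_tensor)
  qed
qed

lemma X_lowest: "i \<in> I \<Longrightarrow> X i 0 (\<tau> v) = sX (h i) (\<tau> v)"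
  and X_lowest_pos: "i \<in> I \<Longrightarrow> m > 0 \<Longrightarrow> X i m (\<tau> v) = 0"
proof -
  assume i: "i \<in> I"
  interpret t: Vector_Spaces.linear "s i" sX "\<lambda>x. \<tau> (v(i := x))" by (rule slot_linear[OF i])
  have l: "lowest_weight_vector (s i) (L i) (h i) (v i)"
    by (rule lowest_weight_generator(1)[OF irr lowest]) (rule i)+
  then show "X i 0 (\<tau> v) = sX (h i) (\<tau> v)"
    by (simp add: X_tensor[OF i] lowest_weight_vector_def t.scale)
  show "X i m (\<tau> v) = 0" if "m > 0"
    using l that by (simp add: X_tensor[OF i] lowest_weight_vector_def t.zero)
qed

text \<open>Entries of \<open>v\<close> are replaced one slot at a time. With the other slots fixed,
  the entries that keep the tensor in \<open>U\<close> form a subrepresentation of the factor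
  containing its lowest weight vector, hence all of it.\<close>

lemma cyclic:
  assumes U: "subspace U" "\<And>i m x. i \<in> I \<Longrightarrow> x \<in> U \<Longrightarrow> X i m x \<in> U" "\<tau> v \<in> U"
  shows "U = UNIV"
proof -
  have "\<tau> u \<in> U" if "finite J" "J \<subseteq> I" "\<And>i. i \<in> I - J \<Longrightarrow> u i = v i" for J u
    using that
  proof (induction J arbitrary: u rule: finite_induct)
    case empty
    have "\<tau> u = \<tau> v"
      using tensor empty by (intro multilinear_cong[of I s sX \<tau>]) (auto simp: tensor_product_def)
    then show ?case using U(3) by simp
  next
    case (insert j J)
    then have j: "j \<in> I" by simp
    interpret t: Vector_Spaces.linear "s j" sX "\<lambda>x. \<tau> (u(j := x))" by (rule slot_linear[OF j])
    have "virasoro_subrep (s j) (L j) {x. \<tau> (u(j := x)) \<in> U}"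
      unfolding virasoro_subrep_def
    proof (intro conjI allI ballI)
      show "t.vs1.subspace {x. \<tau> (u(j := x)) \<in> U}"
        using U(1) by (auto simp: t.vs1.subspace_def t.add t.scale t.zero subspace_def)
      fix n x assume "x \<in> {x. \<tau> (u(j := x)) \<in> U}"
      then show "L j n x \<in> {x. \<tau> (u(j := x)) \<in> U}"
        using U(2)[OF j, of "\<tau> (u(j := x))" n] by (simp add: X_tensor[OF j])
    qed
    moreover have "v j \<in> {x. \<tau> (u(j := x)) \<in> U}"
    proof -
      have "\<tau> (u(j := v j)) \<in> U" using insert.prems by (intro insert.IH) auto
      then show ?thesis by simp
    qed
    ultimately have "{x. \<tau> (u(j := x)) \<in> U} = UNIV"
      by (rule lowest_weight_generator(2)[OF irr[OF j] lowest[OF j]])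
    then have "u j \<in> {x. \<tau> (u(j := x)) \<in> U}" by blast
    then show ?case by simp
  qed
  from this[OF finite_I] have "range \<tau> \<subseteq> U" by auto
  then show ?thesis using tensor_product_span[OF tensor] span_minimal[OF _ U(1)] by blast
qed

text \<open>\<open>\<Xi>\<close> reads off the coefficient of the lowest weight vector. The last
  clause is nondegeneracy: the kernel of \<open>\<Xi>\<close> contains no nonzero invariant
  subspace.\<close>

definition lowest_weight_form :: "('x \<Rightarrow> complex) \<Rightarrow> bool" where
  "lowest_weight_form \<Xi> \<longleftrightarrow> Vector_Spaces.linear sX (*) \<Xi> \<and> \<Xi> (\<tau> v) = 1 \<and>
     (\<forall>i\<in>I. \<forall>k>0. \<forall>x. \<Xi> (X i (- k) x) = 0) \<and>
     (\<forall>U. subspace U \<longrightarrow> (\<forall>i\<in>I. \<forall>m. \<forall>x\<in>U. X i m x \<in> U) \<longrightarrow> (\<forall>x\<in>U. \<Xi> x = 0) \<longrightarrow> U \<subseteq> {0})"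

text \<open>\<open>\<Xi>\<close> is the tensor product of the functionals of the factors. Words of
  modes followed by these functionals separate the points of each factor, so products of them
  separate the points of the tensor product, which gives nondegeneracy.\<close>

lemma lowest_weight_form_exists: "\<exists>\<Xi>. lowest_weight_form \<Xi>"
proof -
  have "\<exists>\<xi>. \<forall>i\<in>I. Vector_Spaces.linear (s i) (*) (\<xi> i) \<and> \<xi> i (v i) = 1 \<and>
      (\<forall>k>0. \<forall>x. \<xi> i (L i (- k) x) = 0)"
    using lowest_weight_functional[OF irr lowest] by (intro bchoice) blast
  then obtain \<xi> where \<xi>: "\<And>i. i \<in> I \<Longrightarrow> Vector_Spaces.linear (s i) (*) (\<xi> i)"
      "\<And>i. i \<in> I \<Longrightarrow> \<xi> i (v i) = 1" "\<And>i k x. i \<in> I \<Longrightarrow> k > 0 \<Longrightarrow> \<xi> i (L i (- k) x) = 0"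
    by blast
  obtain \<Xi> where \<Xi>: "Vector_Spaces.linear sX (*) \<Xi>" "\<And>u. (\<Prod>i\<in>I. \<xi> i (u i)) = \<Xi> (\<tau> u)"
    using tensor_product_universal[OF tensor multilinear_prod[of I s \<xi>] vector_space_complex]
      finite_I \<xi>(1) by blast
  have "\<Xi> (X i (- k) x) = 0" if i: "i \<in> I" and k: "k > 0" for i k x
  proof (rule linear_eq_on_tensors[OF tensor, where x = x])
    interpret C: vector_space "(*) :: complex \<Rightarrow> complex \<Rightarrow> complex" by (rule vector_space_complex)
    interpret vector_space_pair sX "(*) :: complex \<Rightarrow> complex \<Rightarrow> complex" ..
    show "Vector_Spaces.linear sX (*) (\<lambda>x. \<Xi> (X i (- k) x))"
      using Vector_Spaces.linear_compose[OF X_linear[OF i] \<Xi>(1)] by (simp add: o_def)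
    show "Vector_Spaces.linear sX (*) (\<lambda>x. 0 :: complex)" by (rule linear_zero)
    show "\<Xi> (X i (- k) (\<tau> u)) = 0" for u
      using \<xi>(3)[OF i k] i finite_I by (auto simp: X_tensor[OF i] \<Xi>(2)[symmetric] intro!: bexI[of _ i])
  qed
  moreover have "x = 0" if U: "subspace U" "\<And>i m x. i \<in> I \<Longrightarrow> x \<in> U \<Longrightarrow> X i m x \<in> U"
      "\<And>x. x \<in> U \<Longrightarrow> \<Xi> x = 0" and x: "x \<in> U" for U x
  proof (rule ccontr)
    assume "x \<noteq> 0"
    define F where "F = (\<lambda>i. {\<lambda>y. \<xi> i (foldr (L i) ms y) | ms. True})"
    have lin: "Vector_Spaces.linear (s i) (s i) (foldr (L i) ms)" if "i \<in> I" for i ms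
    proof -
      interpret W: vector_space "s i" using tensor that by (simp add: tensor_product_def)
      show ?thesis
      proof (induction ms)
        case Nil
        show ?case using W.linear_id by (simp add: id_def)
      next
        case (Cons m ms)
        then show ?case
          using Vector_Spaces.linear_compose[OF Cons virasoro_linear[OF irr[OF that] lowest[OF that]], of m]
          by (simp add: o_def)
      qed
    qed
    have "\<exists>f. (\<forall>i\<in>I. f i \<in> F i) \<and> (\<forall>g. Vector_Spaces.linear sX (*) g \<longrightarrow>
      (\<forall>u. g (\<tau> u) = (\<Prod>i\<in>I. f i (u i))) \<longrightarrow> g x \<noteq> 0)"
    proof (rule tensor_product_separating[OF tensor finite_I _ _ \<open>x \<noteq> 0\<close>])
      fix i f assume i: "i \<in> I" and "f \<in> F i"
      then show "Vector_Spaces.linear (s i) (*) f"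
        using Vector_Spaces.linear_compose[OF lin[OF i] \<xi>(1)[OF i]] by (auto simp: F_def o_def)
    next
      fix i y assume i: "i \<in> I" and "\<And>f. f \<in> F i \<Longrightarrow> f y = 0"
      then show "y = 0"
        using lowest_weight_functional_separates[OF irr[OF i] lowest[OF i] \<xi>(1)[OF i] \<xi>(2)[OF i]]
        unfolding F_def by blast
    qed
    then obtain f where f: "\<forall>i\<in>I. f i \<in> F i" and sep: "\<And>g. Vector_Spaces.linear sX (*) g \<Longrightarrow>
      (\<And>u. g (\<tau> u) = (\<Prod>i\<in>I. f i (u i))) \<Longrightarrow> g x \<noteq> 0" by blast
    then have "\<forall>i\<in>I. \<exists>ms. f i = (\<lambda>y. \<xi> i (foldr (L i) ms y))" unfolding F_def by blast
    then obtain ms where ms: "\<And>i. i \<in> I \<Longrightarrow> f i = (\<lambda>y. \<xi> i (foldr (L i) (ms i) y))"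
      by (metis bchoice)
    \<comment> \<open>\<open>W\<close> applies the word \<open>ms i\<close> in each slot
      \<open>i\<close> of \<open>J\<close>. Being composed of slot operators it preserves
      \<open>U\<close>, so \<open>\<Xi> (W x)\<close> vanishes, against the choice of the
      words.\<close>
    have "\<exists>W. Vector_Spaces.linear sX sX W \<and> (\<forall>y\<in>U. W y \<in> U) \<and>
        (\<forall>u. W (\<tau> u) = \<tau> (\<lambda>i. if i \<in> J then foldr (L i) (ms i) (u i) else u i))"
      if "finite J" "J \<subseteq> I" for J
      using that
    proof (induction J rule: finite_induct)
      case empty
      show ?case using linear_ident by (intro exI[of _ "\<lambda>x. x"]) simp
    next
      case (insert j J)
      then obtain W where W: "Vector_Spaces.linear sX sX W" "\<And>y. y \<in> U \<Longrightarrow> W y \<in> U"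
        "\<And>u. W (\<tau> u) = \<tau> (\<lambda>i. if i \<in> J then foldr (L i) (ms i) (u i) else u i)" by auto
      have j: "j \<in> I" using insert.prems by simp
      have "Vector_Spaces.linear sX sX (foldr (X j) ns \<circ> W) \<and> (\<forall>y\<in>U. foldr (X j) ns (W y) \<in> U) \<and>
          (\<forall>u. foldr (X j) ns (\<tau> u) = \<tau> (u(j := foldr (L j) ns (u j))))" for ns
      proof (induction ns)
        case Nil
        then show ?case using W by (simp add: o_def)
      next
        case (Cons n ns)
        show ?case
        proof (intro conjI ballI allI)
          show "Vector_Spaces.linear sX sX (foldr (X j) (n # ns) \<circ> W)"
            using Vector_Spaces.linear_compose[OF conjunct1[OF Cons] X_linear[OF j], of n]
            by (simp add: o_def)
          show "foldr (X j) (n # ns) (W y) \<in> U" if "y \<in> U" for y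
            using Cons U(2)[OF j] that by simp
          fix u
          have "foldr (X j) ns (\<tau> u) = \<tau> (u(j := foldr (L j) ns (u j)))" using Cons by blast
          then show "foldr (X j) (n # ns) (\<tau> u) = \<tau> (u(j := foldr (L j) (n # ns) (u j)))"
            by (simp add: X_tensor[OF j])
        qed
      qed
      from this[of "ms j"] show ?case
      proof (intro exI[of _ "foldr (X j) (ms j) \<circ> W"] conjI allI, goal_cases)
        case (3 u)
        have "(\<lambda>i. if i \<in> J then foldr (L i) (ms i) (u i) else u i)(j := foldr (L j) (ms j) (u j))
          = (\<lambda>i. if i \<in> insert j J then foldr (L i) (ms i) (u i) else u i)"
          by auto
        then show ?case using 3 insert.hyps by (simp add: W(3))
      qed (unfold comp_apply, blast+)
    qed
    from this[OF finite_I order_refl] obtain W where W: "Vector_Spaces.linear sX sX W" "\<And>y. y \<in> U \<Longrightarrow> W y \<in> U"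
      "\<And>u. W (\<tau> u) = \<tau> (\<lambda>i. if i \<in> I then foldr (L i) (ms i) (u i) else u i)" by auto
    have "\<Xi> (W x) \<noteq> 0"
    proof (rule sep)
      show "Vector_Spaces.linear sX (*) (\<lambda>y. \<Xi> (W y))"
        using Vector_Spaces.linear_compose[OF W(1) \<Xi>(1)] by (simp add: o_def)
      show "\<Xi> (W (\<tau> u)) = (\<Prod>i\<in>I. f i (u i))" for u
        unfolding W(3) \<Xi>(2)[symmetric] by (intro prod.cong) (simp_all add: ms)
    qed
    then show False using U(3) W(2) x by blast
  qed
  moreover have "\<Xi> (\<tau> v) = 1" unfolding \<Xi>(2)[symmetric] using \<xi>(2) by simp
  ultimately have "lowest_weight_form \<Xi>" using \<Xi>(1) unfolding lowest_weight_form_def by blast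
  then show ?thesis by (rule exI[of _ \<Xi>])
qed

section \<open>The modes \<open>L_T(m)\<close> of the vectors \<open>omega_T\<close>, as signed sums
  of slot operators\<close>

definition code_mode :: "'i set \<Rightarrow> int \<Rightarrow> 'x \<Rightarrow> 'x" where
  "code_mode T m x = (\<Sum>i\<in>I. sX (if i \<in> T then -1 else 1) (X i m x))"

lemma code_mode_linear: "Vector_Spaces.linear sX sX (code_mode T m)"
proof -
  interpret vector_space_pair sX sX ..
  show ?thesis
    unfolding code_mode_def
    by (intro linear_compose_sum ballI linear_compose_scale_right X_linear)
qed

text \<open>Distinct slots commute, so the double sum collapses to its diagonal, where the signs of
  \<open>S\<close> and \<open>T\<close> multiply to the sign of the symmetric difference.\<close>

lemma code_mode_commutator:
  "code_mode S m (code_mode T n x) - code_mode T n (code_mode S m x) =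
    sX (of_int (m - n)) (code_mode (sym_diff S T) (m + n) x) +
    (if m + n = 0 then sX (of_int (m ^ 3 - m) / 12 * c *
      (\<Sum>i\<in>I. if i \<in> sym_diff S T then -1 else 1)) x else 0)"
proof -
  interpret vector_space_pair sX sX ..
  define e where "e = (\<lambda>(T :: 'i set) i. if i \<in> T then -1 else 1 :: complex)"
  have cm: "code_mode T m x = (\<Sum>i\<in>I. sX (e T i) (X i m x))" for T m x
    by (simp add: code_mode_def e_def)
  have ee: "e S i * e T i = e (sym_diff S T) i" for i by (auto simp: e_def)
  have "code_mode S m (code_mode T n x) = (\<Sum>i\<in>I. \<Sum>j\<in>I. sX (e S i * e T j) (X i m (X j n x)))"
  proof -
    have "X i m (\<Sum>j\<in>I. sX (e T j) (X j n x)) = (\<Sum>j\<in>I. sX (e T j) (X i m (X j n x)))" if "i \<in> I" for i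
      by (simp add: linear_sum[OF X_linear[OF that]] linear_scale[OF X_linear[OF that]])
    then show ?thesis by (simp add: cm scale_sum_right)
  qed
  moreover have "code_mode T n (code_mode S m x) = (\<Sum>i\<in>I. \<Sum>j\<in>I. sX (e S i * e T j) (X j n (X i m x)))"
  proof -
    have "X j n (\<Sum>i\<in>I. sX (e S i) (X i m x)) = (\<Sum>i\<in>I. sX (e S i) (X j n (X i m x)))" if "j \<in> I" for j
      by (simp add: linear_sum[OF X_linear[OF that]] linear_scale[OF X_linear[OF that]])
    then show ?thesis
      by (subst sum.swap) (simp add: cm scale_sum_right mult.commute)
  qed
  ultimately have "code_mode S m (code_mode T n x) - code_mode T n (code_mode S m x) =
      (\<Sum>i\<in>I. \<Sum>j\<in>I. sX (e S i * e T j) (X i m (X j n x) - X j n (X i m x)))"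
    by (simp add: sum_subtractf scale_right_diff_distrib)
  also have "\<dots> = (\<Sum>i\<in>I. sX (e (sym_diff S T) i) (sX (of_int (m - n)) (X i (m + n) x) +
        (if m + n = 0 then sX (of_int (m ^ 3 - m) / 12 * c) x else 0)))"
  proof (rule sum.cong[OF refl])
    fix i assume i: "i \<in> I"
    have "(\<Sum>j\<in>I. sX (e S i * e T j) (X i m (X j n x) - X j n (X i m x))) =
        (\<Sum>j\<in>I. if j = i then sX (e S i * e T i) (sX (of_int (m - n)) (X i (m + n) x) +
        (if m + n = 0 then sX (of_int (m ^ 3 - m) / 12 * c) x else 0)) else 0)"
      by (rule sum.cong[OF refl]) (use X_commutator[OF i] in auto)
    then show "(\<Sum>j\<in>I. sX (e S i * e T j) (X i m (X j n x) - X j n (X i m x))) =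
        sX (e (sym_diff S T) i) (sX (of_int (m - n)) (X i (m + n) x) +
        (if m + n = 0 then sX (of_int (m ^ 3 - m) / 12 * c) x else 0))"
      using i finite_I by (simp add: ee)
  qed
  also have "\<dots> = sX (of_int (m - n)) (code_mode (sym_diff S T) (m + n) x) +
    (if m + n = 0 then sX (of_int (m ^ 3 - m) / 12 * c * (\<Sum>i\<in>I. e (sym_diff S T) i)) x else 0)"
  proof -
    have "(\<Sum>i\<in>I. sX (e U i) (sX a (f i))) = sX a (\<Sum>i\<in>I. sX (e U i) (f i))" for U a f
      by (simp add: scale_sum_right mult.commute)
    moreover have "(\<Sum>i\<in>I. sX (e U i) (sX a y)) = sX (a * (\<Sum>i\<in>I. e U i)) y" for U a y
      by (simp add: scale_sum_left sum_distrib_left mult.commute)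
    ultimately show ?thesis
      by (cases "m + n = 0")
        (simp_all only: cm scale_right_distrib sum.distrib if_True if_False scale_zero_right
          sum.neutral_const refl)
  qed
  finally show ?thesis by (simp add: e_def)
qed

end

section \<open>The lattice of a code\<close>

text \<open>The Jacobi identity with \<open>m = 0\<close>: the binomial coefficients of
  \<open>0\<close> leave a single term on the right.\<close>

lemma Jacobi_product:
  assumes "jacobi_identity s Y YW" and "vector_space s"
  shows "YW (Y u l w) n x =
    Sum_any (\<lambda>i::nat. s ((-1) ^ i * (of_int l gchoose i)) (YW u (l - int i) (YW w (n + int i) x)))
     - s ((-1) powi l)
        (Sum_any (\<lambda>i::nat. s ((-1) ^ i * (of_int l gchoose i)) (YW w (n + l - int i) (YW u (int i) x))))"
proof -
  interpret vector_space s by fact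
  have "(\<lambda>i. s (of_int 0 gchoose i) (YW (Y u (l + int i) w) (0 + n - int i) x)) =
      (\<lambda>i. if i = 0 then YW (Y u l w) n x else 0)"
    by (auto simp: fun_eq_iff gbinomial_0_left)
  then have "Sum_any (\<lambda>i. s (of_int 0 gchoose i) (YW (Y u (l + int i) w) (0 + n - int i) x)) = YW (Y u l w) n x"
    by (simp only:) (simp add: Sum_any.delta)
  then show ?thesis
    using assms(1)[unfolded jacobi_identity_def, rule_format, of l u 0 w n x] by simp
qed

text \<open>The vectors all of whose modes preserve \<open>M\<close> form a vertex subring, by
  \<open>Jacobi_product\<close> and the integrality of \<open>l gchoose i\<close>, also for negative
  \<open>l\<close>. So only generators have to be tested.\<close>

lemma vertex_subring_closed_hull:
  assumes W: "vertex_action sV Y one omega c sW YW" and M: "add_subgroup M"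
    and S: "\<And>u m x. u \<in> S \<Longrightarrow> x \<in> M \<Longrightarrow> YW u m x \<in> M"
  shows "vertex_subring_closed YW (vertex_subring Y one hull S) M"
proof -
  interpret vertex_action sV Y one omega c sW YW by (rule W)
  interpret vector_space sW using virasoro by (simp add: virasoro_rep_def)
  interpret complex_space sW ..
  define A where "A = {u. \<forall>m. \<forall>x\<in>M. YW u m x \<in> M}"
  have lin: "module_hom sV sW (\<lambda>u. YW u m x)" for m x
    using linear_left by (simp add: linear_iff_module_hom)
  have int: "(of_int l gchoose i :: complex) \<in> \<int>" for l :: int and i
    unfolding of_int_gbinomial[symmetric] by (rule Ints_of_int)
  have "vertex_subring Y one A"
    unfolding vertex_subring_def
  proof (intro conjI ballI allI)
    show "add_subgroup A"
      using M unfolding A_def add_subgroup_def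
      by (auto simp: module_hom.zero[OF lin] module_hom.add[OF lin] module_hom.neg[OF lin])
    show "one \<in> A" using M by (auto simp: A_def vacuum add_subgroup_def)
    fix u w l assume u: "u \<in> A" and w: "w \<in> A"
    have "YW (Y u l w) n x \<in> M" if "x \<in> M" for n x
      unfolding Jacobi_product[OF jacobi vector_space_axioms] using u w that
      by (intro add_subgroup_diff[OF M] add_subgroup_Sum_any[OF M] add_subgroup_scale_Ints[OF M])
        (auto simp: A_def int power_int_def intro!: Ints_mult Ints_power)
    then show "Y u l w \<in> A" by (simp add: A_def)
  qed
  then have "vertex_subring Y one hull S \<subseteq> A" using S by (intro hull_minimal) (auto simp: A_def)
  then show ?thesis using M by (auto simp: vertex_subring_closed_def A_def)
qed

section \<open>Integrality of commutators and of lowest weights\<close>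

lemma sum_signs:
  assumes A: "finite A"
  shows "(\<Sum>i\<in>A. if i \<in> T then -1 else 1 :: complex) =
    of_int (int (card A) - 2 * int (card (A \<inter> T)))"
proof -
  have "(if i \<in> T then -1 else 1 :: complex) = 1 - (if i \<in> T then 2 else 0)" for i by simp
  then have "(\<Sum>i\<in>A. if i \<in> T then -1 else 1 :: complex) = (\<Sum>i\<in>A. 1 - (if i \<in> T then 2 else 0))"
    by (simp only:)
  then show ?thesis using A by (simp add: sum_subtractf sum.inter_restrict[symmetric])
qed

lemma six_dvd_cube_minus: "(6 :: int) dvd m ^ 3 - m"
proof -
  have "m mod 6 \<in> {0,1,2,3,4,5}" by auto
  then have "(m ^ 3 - m) mod 6 = 0"
    by (subst mod_diff_eq[symmetric], subst power_mod[symmetric]) auto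
  then show ?thesis by (rule mod_0_imp_dvd)
qed

locale virasoro_code_tensor = virasoro_tensor I s sX \<tau> L "1/2" h v X
  for I :: "'i set" and s :: "'i \<Rightarrow> complex \<Rightarrow> 'w::ab_group_add \<Rightarrow> 'w"
    and sX :: "complex \<Rightarrow> 'x::ab_group_add \<Rightarrow> 'x" and \<tau> L h v X +
  fixes C :: "'i set set"
  assumes card_I: "4 dvd card I"
    and code: "binary_linear_code I C" "C \<subseteq> even_code I"
    and separating: "\<And>i j. i \<in> I \<Longrightarrow> j \<in> I \<Longrightarrow> i \<noteq> j \<Longrightarrow> \<exists>T\<in>C. i \<in> T \<and> j \<notin> T"
    and weights: "\<And>i. i \<in> I \<Longrightarrow> h i \<in> {0, 1/2}" "even (card {i \<in> I. h i = 1/2})"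
begin

lemma code_mode_commutator_integral:
  assumes "S \<in> C" "T \<in> C"
  shows "\<exists>k. code_mode S m (code_mode T n x) = code_mode T n (code_mode S m x) +
    sX (of_int (m - n)) (code_mode (sym_diff S T) (m + n) x) + sX (of_int k) x"
proof -
  have "sym_diff S T \<in> C" using code(1) assms by (auto simp: binary_linear_code_def)
  then have U: "sym_diff S T \<subseteq> I" "even (card (sym_diff S T))"
    using code(2) by (auto simp: even_code_def)
  \<comment> \<open>\<open>q\<close> is the sum over \<open>I\<close> of the signs of
    \<open>sym_diff S T\<close>. Its factor \<open>4\<close> and the factor \<open>6\<close> of
    \<open>m ^ 3 - m\<close> cancel the denominator \<open>24\<close> of the central term.\<close>
  define q where "q = int (card I) - 2 * int (card (sym_diff S T))"
  have "(4 :: int) dvd int (card I)" "(4 :: int) dvd 2 * int (card (sym_diff S T))"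
    using card_I U(2) by presburger+
  then have "4 dvd q" unfolding q_def by (rule dvd_diff)
  then obtain q' where q': "q = 4 * q'" by blast
  obtain r where r: "m ^ 3 - m = 6 * r" using six_dvd_cube_minus by blast
  have "(\<Sum>i\<in>I. if i \<in> sym_diff S T then -1 else 1 :: complex) = of_int (4 * q')"
    using sum_signs[OF finite_I, of "sym_diff S T"] U(1) by (simp only: q_def Int_absorb1 flip: q')
  then have "of_int (m ^ 3 - m) / 12 * (1 / 2) * (\<Sum>i\<in>I. if i \<in> sym_diff S T then -1 else 1 :: complex)
      = of_int (r * q')"
    by (simp only: r) simp
  then show ?thesis
    using code_mode_commutator[of S m T n x]
    by (intro exI[of _ "if m + n = 0 then r * q' else 0"])
      (simp only: diff_eq_eq split: if_split, auto simp: algebra_simps)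
qed

text \<open>The eigenvalue of \<open>L_T(0)\<close> is half the sum of the signs over the positions
  of weight \<open>1/2\<close>, an integer because there is an even number of them.\<close>

lemma code_mode_lowest: "T \<in> C \<Longrightarrow> \<exists>k. code_mode T 0 (\<tau> v) = sX (of_int k) (\<tau> v)"
  and code_mode_lowest_pos: "m > 0 \<Longrightarrow> code_mode T m (\<tau> v) = 0"
proof -
  show "code_mode T m (\<tau> v) = 0" if "m > 0"
    using that by (simp add: code_mode_def X_lowest_pos)
  let ?H = "{i \<in> I. h i = 1/2}"
  have "(\<Sum>i\<in>I. (if i \<in> T then -1 else 1) * h i) = (\<Sum>i\<in>?H. (if i \<in> T then -1 else 1) * (1/2))"
    using finite_I weights(1) by (intro sum.mono_neutral_cong_right) auto
  also have "\<dots> = (1/2) * (\<Sum>i\<in>?H. if i \<in> T then -1 else 1)"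
    by (simp add: sum_distrib_left mult.commute)
  also have "\<dots> = (1/2) * of_int (int (card ?H) - 2 * int (card (?H \<inter> T)))"
    using finite_I by (subst sum_signs) auto
  also obtain p where "int (card ?H) = 2 * p" using weights(2) by (metis even_of_nat evenE)
  then have "(1/2) * of_int (int (card ?H) - 2 * int (card (?H \<inter> T))) =
      (of_int (p - int (card (?H \<inter> T))) :: complex)"
    by simp
  finally have "(\<Sum>i\<in>I. (if i \<in> T then -1 else 1) * h i) = of_int (p - int (card (?H \<inter> T)))" .
  moreover have "code_mode T 0 (\<tau> v) = sX (\<Sum>i\<in>I. (if i \<in> T then -1 else 1) * h i) (\<tau> v)"
    by (simp add: code_mode_def X_lowest scale_sum_left)
  ultimately show "\<exists>k. code_mode T 0 (\<tau> v) = sX (of_int k) (\<tau> v)" by metis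
qed

text \<open>The characters \<open>T \<mapsto> \<plusminus>1\<close> of the code belonging to distinct coordinates are orthogonal.\<close>

lemma X_closed:
  assumes U: "subspace U" "\<And>T m x. T \<in> C \<Longrightarrow> x \<in> U \<Longrightarrow> code_mode T m x \<in> U"
    and i: "i \<in> I" and x: "x \<in> U"
  shows "X i m x \<in> U"
proof -
  define e where "e = (\<lambda>(T :: 'i set) i. if i \<in> T then -1 else 1 :: complex)"
  have C: "C \<subseteq> Pow I" "{} \<in> C" "\<And>S T. S \<in> C \<Longrightarrow> T \<in> C \<Longrightarrow> sym_diff S T \<in> C"
    using code(1) by (auto simp: binary_linear_code_def)
  have fC: "finite C" using C(1) finite_I by (meson finite_Pow_iff finite_subset)
  have ortho: "(\<Sum>T\<in>C. e T i * e T j) = (if j = i then of_nat (card C) else 0)" if j: "j \<in> I" for j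
  proof (cases "j = i")
    case True
    moreover have "e T i * e T i = 1" for T by (simp add: e_def)
    ultimately show ?thesis by simp
  next
    case False
    then obtain S where S: "S \<in> C" "i \<in> S" "j \<notin> S" using separating i j by blast
    \<comment> \<open>Translation by a code word \<open>S\<close> containing \<open>i\<close> but
      not \<open>j\<close> permutes \<open>C\<close> and changes the sign of every summand, so the
      sum is its own negative.\<close>
    have "bij_betw (sym_diff S) C C"
      by (rule bij_betwI[where g = "sym_diff S"]) (use C(3) S(1) in auto)
    then have "(\<Sum>T\<in>C. e T i * e T j) = (\<Sum>T\<in>C. e (sym_diff S T) i * e (sym_diff S T) j)"
      by (rule sum.reindex_bij_betw[symmetric])
    also have "\<dots> = (\<Sum>T\<in>C. - (e T i * e T j))"
      by (rule sum.cong[OF refl]) (use S in \<open>auto simp: e_def\<close>)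
    finally show ?thesis using False by (simp add: sum_negf)
  qed
  \<comment> \<open>Fourier inversion: summing the code modes against the character of
    \<open>i\<close> leaves only slot \<open>i\<close>, with the factor \<open>card C\<close>, which
    is nonzero.\<close>
  have "(\<Sum>T\<in>C. sX (e T i) (code_mode T m x)) = (\<Sum>j\<in>I. \<Sum>T\<in>C. sX (e T i * e T j) (X j m x))"
    by (subst sum.swap) (simp add: code_mode_def e_def scale_sum_right)
  also have "\<dots> = (\<Sum>j\<in>I. if j = i then sX (of_nat (card C)) (X i m x) else 0)"
    by (rule sum.cong[OF refl]) (auto simp: ortho simp flip: scale_sum_left)
  also have "\<dots> = sX (of_nat (card C)) (X i m x)" using i finite_I by simp
  finally have "sX (1 / of_nat (card C)) (\<Sum>T\<in>C. sX (e T i) (code_mode T m x)) = X i m x"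
    using fC C(2) by (auto simp: card_eq_0_iff)
  moreover have "sX (1 / of_nat (card C)) (\<Sum>T\<in>C. sX (e T i) (code_mode T m x)) \<in> U"
    using U x by (intro subspace_scale subspace_sum) auto
  ultimately show ?thesis by simp
qed

section \<open>The lattice generated by the lowering modes\<close>

definition lowering_closed :: "'x set \<Rightarrow> bool" where
  "lowering_closed A \<longleftrightarrow> add_subgroup A \<and> (\<forall>T\<in>C. \<forall>k>0. \<forall>x\<in>A. code_mode T (- k) x \<in> A)"

definition code_lattice :: "'x set" where
  "code_lattice = lowering_closed hull {\<tau> v}"

lemma code_lattice_lowering_closed: "lowering_closed code_lattice"
  unfolding code_lattice_def
  by (rule hull_in) (auto simp: lowering_closed_def add_subgroup_def)

lemma lowest_in_code_lattice: "\<tau> v \<in> code_lattice"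
  unfolding code_lattice_def using hull_subset[of "{\<tau> v}" lowering_closed] by simp

text \<open>The argument of \<open>lowering_operators_generate\<close> over the integers:
  commutators stay in the lattice because their central terms are integers and \<open>C\<close> is
  closed under symmetric difference.\<close>

lemma code_lattice_closed:
  assumes "T \<in> C" "x \<in> code_lattice"
  shows "code_mode T m x \<in> code_lattice"
proof -
  have L: "add_subgroup code_lattice"
    "\<And>T k x. T \<in> C \<Longrightarrow> k > 0 \<Longrightarrow> x \<in> code_lattice \<Longrightarrow> code_mode T (- k) x \<in> code_lattice"
    using code_lattice_lowering_closed by (auto simp: lowering_closed_def)
  have add: "x + y \<in> code_lattice" if "x \<in> code_lattice" "y \<in> code_lattice" for x y
    using L(1) that by (simp add: add_subgroup_def)
  have lin: "module_hom sX sX (code_mode T m)" for T m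
    using code_mode_linear by (simp add: linear_iff_module_hom)
  define E where "E = {x \<in> code_lattice. \<forall>T\<in>C. \<forall>m. code_mode T m x \<in> code_lattice}"
  have "lowering_closed E"
    unfolding lowering_closed_def
  proof (intro conjI ballI allI impI)
    show "add_subgroup E"
      using L(1) unfolding E_def add_subgroup_def
      by (auto simp: module_hom.zero[OF lin] module_hom.add[OF lin] module_hom.neg[OF lin])
    fix T x and k :: int assume T: "T \<in> C" and k: "k > 0" and x: "x \<in> E"
    have "code_mode S m (code_mode T (- k) x) \<in> code_lattice" if S: "S \<in> C" for S m
    proof -
      have ST: "sym_diff S T \<in> C" using code(1) S T by (auto simp: binary_linear_code_def)
      obtain j where "code_mode S m (code_mode T (- k) x) = code_mode T (- k) (code_mode S m x) +
        sX (of_int (m - - k)) (code_mode (sym_diff S T) (m + - k) x) + sX (of_int j) x"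
        using code_mode_commutator_integral[OF S T] by blast
      moreover have "\<dots> \<in> code_lattice"
        using x S T k ST by (intro add L(2) add_subgroup_scale_int[OF L(1)]) (auto simp: E_def)
      ultimately show ?thesis by simp
    qed
    then show "code_mode T (- k) x \<in> E" using x T k L(2) by (auto simp: E_def)
  qed
  moreover have "\<tau> v \<in> E"
  proof -
    have "code_mode T m (\<tau> v) \<in> code_lattice" if T: "T \<in> C" for T m
    proof (cases m "0 :: int" rule: linorder_cases)
      case less
      then show ?thesis using L(2)[OF T, of "- m" "\<tau> v"] lowest_in_code_lattice by simp
    next
      case equal
      then show ?thesis using code_mode_lowest[OF T] lowest_in_code_lattice
        by (auto intro: add_subgroup_scale_int[OF L(1)])
    next
      case greater
      then show ?thesis using code_mode_lowest_pos L(1) by (simp add: add_subgroup_def)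
    qed
    then show ?thesis using lowest_in_code_lattice by (simp add: E_def)
  qed
  ultimately have "code_lattice \<subseteq> E"
    unfolding code_lattice_def by (intro hull_minimal) auto
  then show ?thesis using assms by (auto simp: E_def)
qed

text \<open>Lowering modes only produce vectors in the kernel of \<open>\<Xi>\<close>, so on the
  lattice \<open>\<Xi>\<close> takes only integer multiples of its value \<open>1\<close> at
  \<open>\<tau> v\<close>.\<close>

lemma lowest_weight_form_integral:
  assumes \<Xi>: "lowest_weight_form \<Xi>" and x: "x \<in> code_lattice"
  shows "\<Xi> x \<in> \<int>"
proof -
  interpret \<Xi>: Vector_Spaces.linear sX "(*)" \<Xi> using \<Xi> by (simp add: lowest_weight_form_def)
  have "lowering_closed {x. \<Xi> x \<in> \<int>}"
    using \<Xi> unfolding lowering_closed_def add_subgroup_def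
    by (auto simp: \<Xi>.zero \<Xi>.add \<Xi>.neg \<Xi>.sum \<Xi>.scale code_mode_def lowest_weight_form_def)
  moreover have "\<tau> v \<in> {x. \<Xi> x \<in> \<int>}" using \<Xi> by (simp add: lowest_weight_form_def)
  ultimately have "code_lattice \<subseteq> {x. \<Xi> x \<in> \<int>}"
    unfolding code_lattice_def by (intro hull_minimal) auto
  then show ?thesis using x by blast
qed

text \<open>The assumptions describe \<open>M\<close> as the smallest subgroup containing
  \<open>\<tau> v\<close> and closed under code modes. The code word \<open>{}\<close> has only plus
  signs, so \<open>code_mode {} 0\<close> is the total \<open>L(0)\<close>.\<close>

theorem integral_form:
  assumes fin: "\<And>a. \<exists>B. finite B \<and> weight_space sX (code_mode {}) a = span B"
    and M: "add_subgroup M" "\<tau> v \<in> M" "\<And>T m x. T \<in> C \<Longrightarrow> x \<in> M \<Longrightarrow> code_mode T m x \<in> M"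
      "\<And>N. add_subgroup N \<Longrightarrow> \<tau> v \<in> N \<Longrightarrow>
        (\<And>T m x. T \<in> C \<Longrightarrow> x \<in> N \<Longrightarrow> code_mode T m x \<in> N) \<Longrightarrow> M \<subseteq> N"
  shows "\<exists>B. independent B \<and> span B = UNIV \<and> M = int_span sX B"
    and "M = add_subgroup hull (\<Union>a. weight_space sX (code_mode {}) a \<inter> M)"
proof -
  define G where "G = add_subgroup hull (\<Union>a. weight_space sX (code_mode {}) a \<inter> M)"
  have empty: "{} \<in> C" using code(1) by (simp add: binary_linear_code_def)
  have G: "add_subgroup G" unfolding G_def by (rule add_subgroup_hull)
  have homogeneous: "x \<in> G" if "x \<in> weight_space sX (code_mode {}) a" "x \<in> M" for a x
    unfolding G_def using that by (intro hull_inc) blast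
  have lin: "module_hom sX sX (code_mode T m)" for T m
    using code_mode_linear by (simp add: linear_iff_module_hom)
  have shift: "code_mode T m x \<in> weight_space sX (code_mode {}) (a - of_int m)"
    if "x \<in> weight_space sX (code_mode {}) a" for T m x a
  proof -
    have "code_mode {} 0 (code_mode T m x) - code_mode T m (code_mode {} 0 x) =
        sX (of_int (- m)) (code_mode T m x)"
      using code_mode_commutator[of "{}" 0 T m x] by simp
    then have "code_mode {} 0 (code_mode T m x) = sX (a - of_int m) (code_mode T m x)"
      using that by (simp add: weight_space_def module_hom.scale[OF lin] diff_eq_eq scale_left_diff_distrib)
    then show ?thesis by (simp add: weight_space_def)
  qed
  have GM: "G \<subseteq> M" unfolding G_def by (intro hull_minimal M(1)) auto
  \<comment> \<open>The sum \<open>G\<close> of the homogeneous parts contains the homogeneous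
    vector \<open>\<tau> v\<close>, and code modes shift weights, so \<open>G\<close> is closed
    under them; minimality of \<open>M\<close> applies.\<close>
  have MG: "M \<subseteq> G"
  proof (rule M(4)[OF G])
    have "code_mode {} 0 (\<tau> v) = sX (\<Sum>i\<in>I. h i) (\<tau> v)"
      by (simp add: code_mode_def X_lowest scale_sum_left)
    then show "\<tau> v \<in> G"
      using M(2) by (intro homogeneous[of _ "\<Sum>i\<in>I. h i"]) (simp_all add: weight_space_def)
    fix T m x assume T: "T \<in> C" and x: "x \<in> G"
    have "add_subgroup {x. code_mode T m x \<in> G}"
      using G by (simp add: add_subgroup_def module_hom.zero[OF lin] module_hom.add[OF lin]
          module_hom.neg[OF lin])
    moreover have "(\<Union>a. weight_space sX (code_mode {}) a \<inter> M) \<subseteq> {x. code_mode T m x \<in> G}"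
      using homogeneous shift M(3)[OF T] by blast
    ultimately have "G \<subseteq> {x. code_mode T m x \<in> G}"
      by (subst (1) G_def) (rule hull_minimal)
    then show "code_mode T m x \<in> G" using x by blast
  qed
  show "M = add_subgroup hull (\<Union>a. weight_space sX (code_mode {}) a \<inter> M)"
    using GM MG G_def by blast
  have latt: "M \<subseteq> code_lattice"
    using code_lattice_lowering_closed lowest_in_code_lattice code_lattice_closed
    by (intro M(4)) (auto simp: lowering_closed_def)
  obtain \<Xi> where \<Xi>: "lowest_weight_form \<Xi>" using lowest_weight_form_exists by blast
  have \<Xi>_lin: "Vector_Spaces.linear sX (*) \<Xi>" using \<Xi> by (simp add: lowest_weight_form_def)
  interpret \<Xi>: Vector_Spaces.linear sX "(*)" \<Xi> by (rule \<Xi>_lin)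
  define word where "word = foldr (\<lambda>(T, m). code_mode T m)"
  \<comment> \<open>Words preserve \<open>M\<close>, and \<open>M\<close> lies in the lattice, so
    \<open>\<Xi>\<close> after any word is integral on \<open>M\<close>.\<close>
  define F where "F = {\<lambda>x. \<Xi> (word ts x) | ts. fst ` set ts \<subseteq> C}"
  have word_lin: "Vector_Spaces.linear sX sX (word ts)" for ts
  proof (induction ts)
    case Nil
    show ?case using linear_id by (simp add: word_def id_def)
  next
    case (Cons t ts)
    then show ?case
      using Vector_Spaces.linear_compose[OF Cons code_mode_linear[of "fst t" "snd t"]]
      by (simp add: word_def o_def case_prod_unfold)
  qed
  have word_M: "word ts x \<in> M" if "fst ` set ts \<subseteq> C" "x \<in> M" for ts x
    using that by (induction ts) (auto simp: word_def M(3))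
  show "\<exists>B. independent B \<and> span B = UNIV \<and> M = int_span sX B"
  proof (rule graded_integral_basis[where L = "code_mode {}" and F = F])
    show "Vector_Spaces.linear sX sX (code_mode {} 0)" by (rule code_mode_linear)
    show "\<exists>B. finite B \<and> weight_space sX (code_mode {}) a = span B" for a by (rule fin)
    show "add_subgroup M" by (rule M(1))
    show "M \<subseteq> add_subgroup hull (\<Union>a. weight_space sX (code_mode {}) a \<inter> M)"
      using MG G_def by blast
    show "Vector_Spaces.linear sX (*) f" if "f \<in> F" for f
      using that Vector_Spaces.linear_compose[OF word_lin \<Xi>_lin] by (auto simp: F_def o_def)
    show "f g \<in> \<int>" if "f \<in> F" "g \<in> M" for f g
      using that word_M latt lowest_weight_form_integral[OF \<Xi>] by (auto simp: F_def)
    show "span M = UNIV"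
    proof (rule cyclic)
      show "\<tau> v \<in> span M" using M(2) by (rule span_base)
      have "code_mode T m x \<in> span M" if T: "T \<in> C" and x: "x \<in> span M" for T m x
      proof -
        interpret c: Vector_Spaces.linear sX sX "code_mode T m" by (rule code_mode_linear)
        have "span (code_mode T m ` M) \<subseteq> span M"
          using M(3)[OF T] by (intro span_mono) auto
        then show ?thesis using x unfolding c.span_image by blast
      qed
      then show "X i m x \<in> span M" if "i \<in> I" "x \<in> span M" for i m x
        using X_closed[OF subspace_span _ that] by blast
    qed (rule subspace_span)
    fix x assume x: "\<And>f. f \<in> F \<Longrightarrow> f x = 0"
    \<comment> \<open>The common kernel of \<open>F\<close> is stable under the code modes, hence
      under the slot operators by \<open>X_closed\<close>, and lies in the kernel of
      \<open>\<Xi>\<close>; nondegeneracy makes it zero.\<close>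
    define U where "U = {x. \<forall>f\<in>F. f x = 0}"
    have U_iff: "x \<in> U \<longleftrightarrow> (\<forall>ts. fst ` set ts \<subseteq> C \<longrightarrow> \<Xi> (word ts x) = 0)" for x
      by (auto simp: U_def F_def)
    have word_hom: "module_hom sX sX (word ts)" for ts
      using word_lin by (simp add: linear_iff_module_hom)
    have sub: "subspace U"
      unfolding subspace_def
      by (auto simp: U_iff \<Xi>.zero \<Xi>.add \<Xi>.scale module_hom.zero[OF word_hom] module_hom.add[OF word_hom]
          module_hom.scale[OF word_hom])
    moreover have "code_mode T m x \<in> U" if T: "T \<in> C" and x: "x \<in> U" for T m x
    proof -
      have "\<Xi> (word (ts @ [(T, m)]) x) = 0" if "fst ` set ts \<subseteq> C" for ts
        using x[unfolded U_iff, rule_format, of "ts @ [(T, m)]"] T that by auto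
      then show ?thesis by (simp add: U_iff word_def)
    qed
    then have "\<And>i m x. i \<in> I \<Longrightarrow> x \<in> U \<Longrightarrow> X i m x \<in> U" using X_closed[OF sub] by blast
    moreover have "\<Xi> x = 0" if "x \<in> U" for x
      using that[unfolded U_iff, rule_format, of "[]"] by (simp add: word_def)
    ultimately have "U \<subseteq> {0}" using \<Xi> unfolding lowest_weight_form_def by blast
    then show "x = 0" using x by (auto simp: U_def)
  qed
qed

end


section \<open>Modules for the vertex subring of a code\<close>

text \<open>A term of the sum vanishes unless the mode is \<open>-1\<close> at every vacuum slot.
  Such slots contribute \<open>0\<close> to the index sum, which forces mode \<open>m\<close> at
  slot \<open>i\<close>.\<close>

lemma tensor_vertex_operator_factor:
  assumes Y: "tensor_vertex_operator I YW \<tau> \<tau>W YX" and \<tau>W: "multilinear I s sX \<tau>W"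
    and fin: "finite I" and i: "i \<in> I"
    and vacuum: "\<And>j m w. j \<in> I \<Longrightarrow> YW j one m w = (if m = -1 then w else 0)"
  shows "YX (omega_factor \<tau> one omega i) m (\<tau>W w) = \<tau>W (w(i := YW i omega m (w i)))"
proof -
  define u where "u = (\<lambda>_. one)(i := omega)"
  define t where "t = (\<lambda>k. \<tau>W (\<lambda>j. YW j (u j) (k j) (w j)))"
  define P where "P = (\<lambda>k. k \<in> I \<rightarrow>\<^sub>E (UNIV :: int set) \<and> (\<Sum>j\<in>I. (k j + 1)) = m + 1)"
  \<comment> \<open>The one surviving index family, restricted to \<open>I\<close> because the sum
    ranges over extensional functions.\<close>
  define k0 where "k0 = (\<lambda>j\<in>I. if j = i then m else -1)"
  have "(if P k then t k else 0) = (if k = k0 then \<tau>W (w(i := YW i omega m (w i))) else 0)" for k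
  proof (cases "k = k0")
    case True
    have "(\<Sum>j\<in>I. (k0 j + 1)) = (\<Sum>j\<in>I. if j = i then m + 1 else 0)"
      by (rule sum.cong) (auto simp: k0_def)
    then have "P k0" using fin i by (auto simp: P_def k0_def)
    moreover have "t k0 = \<tau>W (w(i := YW i omega m (w i)))"
      unfolding t_def by (rule multilinear_cong[OF \<tau>W]) (auto simp: u_def k0_def vacuum)
    ultimately show ?thesis using True by simp
  next
    case False
    have "t k = 0" if k: "P k"
    proof (cases "\<exists>j\<in>I. j \<noteq> i \<and> k j \<noteq> -1")
      case True
      then obtain j where j: "j \<in> I" "j \<noteq> i" "k j \<noteq> -1" by blast
      define y where "y = (\<lambda>j. YW j (u j) (k j) (w j))"
      interpret l: Vector_Spaces.linear "s j" sX "\<lambda>x. \<tau>W (y(j := x))"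
        using \<tau>W j(1) by (simp add: multilinear_def)
      have "y j = 0" using j by (simp add: y_def u_def vacuum)
      then have "y = y(j := 0)" by (auto simp: fun_eq_iff)
      then show ?thesis unfolding t_def y_def[symmetric] using l.zero by metis
    next
      case no: False
      have "(\<Sum>j\<in>I. (k j + 1)) = (\<Sum>j\<in>I. if j = i then k i + 1 else 0)"
        by (rule sum.cong) (use no in auto)
      then have "k i = m" using k fin i by (simp add: P_def)
      moreover have "k \<in> extensional I" using k by (simp add: P_def PiE_def)
      ultimately have "k = k0" using no by (auto simp: k0_def fun_eq_iff extensional_def)
      then show ?thesis using False by simp
    qed
    then show ?thesis using False by simp
  qed
  then have eq: "(\<lambda>k. if P k then t k else 0) =
      (\<lambda>k. if k = k0 then \<tau>W (w(i := YW i omega m (w i))) else 0)"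
    by (rule ext)
  have "YX (omega_factor \<tau> one omega i) m (\<tau>W w) = Sum_any (\<lambda>k. if P k then t k else 0)"
    using Y unfolding tensor_vertex_operator_def omega_factor_def u_def[symmetric] P_def t_def by blast
  also have "\<dots> = \<tau>W (w(i := YW i omega m (w i)))"
    unfolding eq by (rule Sum_any.delta)
  finally show ?thesis .
qed

theorem proposition6p1:
  fixes n :: nat and \<Omega> :: "nat set" and C :: "nat set set" and h :: "nat \<Rightarrow> complex"
    and sV :: "complex \<Rightarrow> 'v::ab_group_add \<Rightarrow> 'v"
    and Y :: "'v \<Rightarrow> int \<Rightarrow> 'v \<Rightarrow> 'v" and one omega :: 'v
    and sT :: "complex \<Rightarrow> 't::ab_group_add \<Rightarrow> 't"
    and YT :: "'t \<Rightarrow> int \<Rightarrow> 't \<Rightarrow> 't" and oneT omegaT :: 't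
    and \<tau>V :: "(nat \<Rightarrow> 'v) \<Rightarrow> 't"
    and sL :: "nat \<Rightarrow> complex \<Rightarrow> 'w::ab_group_add \<Rightarrow> 'w"
    and YL :: "nat \<Rightarrow> 'v \<Rightarrow> int \<Rightarrow> 'w \<Rightarrow> 'w" and v :: "nat \<Rightarrow> 'w"
    and sW :: "complex \<Rightarrow> 'x::ab_group_add \<Rightarrow> 'x"
    and YW :: "'t \<Rightarrow> int \<Rightarrow> 'x \<Rightarrow> 'x"
    and \<tau>W :: "(nat \<Rightarrow> 'w) \<Rightarrow> 'x"
  assumes n: "n > 0" "4 dvd n" and \<Omega>: "\<Omega> = {1..n}"
    and code: "binary_linear_code \<Omega> C" "C \<subseteq> even_code \<Omega>" "\<Omega> \<in> C"
    and separating: "\<And>i j. i \<in> \<Omega> \<Longrightarrow> j \<in> \<Omega> \<Longrightarrow> i \<noteq> j \<Longrightarrow> \<exists>T\<in>C. i \<in> T \<and> j \<notin> T"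
    and H: "\<And>i. i \<in> \<Omega> \<Longrightarrow> h i \<in> {0, 1/2}" "even (card {i \<in> \<Omega>. h i = 1/2})"
    and L0: "simple_virasoro_voa sV Y one omega (1/2)"
    and LT: "tensor_power_voa \<Omega> sV Y one omega (1/2) \<tau>V sT YT oneT omegaT"
    and Lh: "\<And>i. i \<in> \<Omega> \<Longrightarrow> virasoro_voa_module sV Y one omega (1/2) (sL i) (YL i) (h i)"
    and v: "\<And>i. i \<in> \<Omega> \<Longrightarrow>
        weight_space (sL i) (vir_mode (YL i) omega) (h i) = module.span (sL i) {v i}"
    and WH: "tensor_product_module \<Omega> sV Y one omega (1/2) \<tau>V sT YT oneT omegaT sL YL \<tau>W sW YW"
  shows "module_integral_form sW YW omegaT
           (code_vertex_subring \<Omega> \<tau>V one omega YT oneT C)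
           (generated_module YW (code_vertex_subring \<Omega> \<tau>V one omega YT oneT C) (\<tau>W v))"
proof -
  define A where "A = code_vertex_subring \<Omega> \<tau>V one omega YT oneT C"
  define M where "M = generated_module YW A (\<tau>W v)"
  \<comment> \<open>In Virasoro indexing, \<open>X i m\<close> is component \<open>m + 1\<close> of
    the conformal vector of factor \<open>i\<close>.\<close>
  define X where "X = (\<lambda>i. vir_mode YW (omega_factor \<tau>V one omega i))"
  have fin: "finite \<Omega>" by (simp add: \<Omega>)
  have T: "tensor_product \<Omega> sL sW \<tau>W" "tensor_vertex_operator \<Omega> YL \<tau>V \<tau>W YW"
    using WH by (simp_all add: tensor_product_module_def)
  have W: "vertex_action sT YT oneT omegaT (of_nat (card \<Omega>) * (1/2)) sW YW"
    using WH by (simp add: tensor_product_module_def voa_module_def)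
  interpret W: vertex_action sT YT oneT omegaT "of_nat (card \<Omega>) * (1/2)" sW YW by (rule W)
  have vacuum: "YL i one m w = (if m = -1 then w else 0)" if "i \<in> \<Omega>" for i m w
    using Lh[OF that] by (auto simp: virasoro_voa_module_def voa_module_def vertex_action.vacuum)
  interpret virasoro_code_tensor \<Omega> sL sW \<tau>W "\<lambda>i. vir_mode (YL i) omega" h v X C
  proof (intro virasoro_code_tensor.intro virasoro_tensor.intro virasoro_code_tensor_axioms.intro)
    show "irreducible_virasoro_lowest_weight (sL i) (vir_mode (YL i) omega) (1/2) (h i)"
      if "i \<in> \<Omega>" for i using Lh[OF that] by (simp add: virasoro_voa_module_def)
    show "X i m (\<tau>W w) = \<tau>W (w(i := vir_mode (YL i) omega m (w i)))" if "i \<in> \<Omega>" for i m w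
      unfolding X_def using T that vacuum
      by (intro tensor_vertex_operator_factor[OF T(2) _ fin]) (auto simp: tensor_product_def)
    show "Vector_Spaces.linear sW sW (X i m)" for i m
      unfolding X_def by (rule W.linear_right)
    show "4 dvd card \<Omega>" using n(2) by (simp add: \<Omega>)
  qed (use fin T v code separating H in auto)
  have lin: "module_hom sT sW (\<lambda>u. YW u m x)" for m x
    using W.linear_left by (simp add: linear_iff_module_hom)
  \<comment> \<open>Splitting \<open>\<Omega>\<close> into \<open>T\<close> and its complement
    matches the signs of \<open>omega_code\<close>, and \<open>YW\<close> is linear in its first
    argument.\<close>
  have mode: "code_mode T m = vir_mode YW (omega_code \<Omega> \<tau>V one omega T) m" if "T \<subseteq> \<Omega>" for T m
  proof
    fix x
    have "code_mode T m x = (\<Sum>i\<in>\<Omega> - T. X i m x) + (\<Sum>i\<in>T. - X i m x)"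
      unfolding code_mode_def
      by (subst sum.subset_diff[OF that fin]) (auto intro!: arg_cong2[of _ _ _ _ "(+)"] sum.cong)
    then show "code_mode T m x = vir_mode YW (omega_code \<Omega> \<tau>V one omega T) m x"
      by (simp add: omega_code_def X_def module_hom.diff[OF lin] module_hom.sum[OF lin] sum_negf)
  qed
  have CP: "T \<subseteq> \<Omega>" if "T \<in> C" for T using code(1) that by (auto simp: binary_linear_code_def)
  \<comment> \<open>The empty code word gives the conformal vector of the tensor power, so the
    conformal grading is that of \<open>code_mode {} 0\<close>.\<close>
  have L: "vir_mode YW omegaT = code_mode {}"
    using LT mode[of "{}"] by (auto simp: tensor_power_voa_def omega_code_def)
  \<comment> \<open>Closure under the modes of the generators implies closure under the whole vertex
    subring. Hence \<open>M\<close> has the minimality that \<open>integral_form\<close> asks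
    for.\<close>
  have closed: "vertex_subring_closed YW A N"
    if "add_subgroup N" "\<And>T m x. T \<in> C \<Longrightarrow> x \<in> N \<Longrightarrow> code_mode T m x \<in> N" for N
    unfolding A_def code_vertex_subring_def
  proof (rule vertex_subring_closed_hull[OF W that(1)])
    fix u m x assume "u \<in> omega_code \<Omega> \<tau>V one omega ` C" "x \<in> N"
    then obtain T where "T \<in> C" "u = omega_code \<Omega> \<tau>V one omega T" by blast
    then show "YW u m x \<in> N"
      using that(2)[of T x "m - 1"] \<open>x \<in> N\<close> mode[OF CP] by simp
  qed
  have MA: "vertex_subring_closed YW A M"
    unfolding M_def generated_module_def
    by (rule hull_in) (auto simp: vertex_subring_closed_def add_subgroup_def)
  have M: "add_subgroup M" "\<tau>W v \<in> M"
    using MA hull_subset[of "{\<tau>W v}"] by (auto simp: vertex_subring_closed_def M_def generated_module_def)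
  have "omega_code \<Omega> \<tau>V one omega T \<in> A" if "T \<in> C" for T
    unfolding A_def code_vertex_subring_def using that by (intro hull_inc) blast
  then have M_modes: "code_mode T m x \<in> M" if "T \<in> C" "x \<in> M" for T m x
    using MA that mode[OF CP] by (simp add: vertex_subring_closed_def)
  have M_least: "M \<subseteq> N" if "add_subgroup N" "\<tau>W v \<in> N"
      "\<And>T m x. T \<in> C \<Longrightarrow> x \<in> N \<Longrightarrow> code_mode T m x \<in> N" for N
    unfolding M_def generated_module_def using that closed by (intro hull_minimal) auto
  have fd: "\<exists>B. finite B \<and> weight_space sW (code_mode {}) a = span B" for a
    using W.finite_dimensional_weight_spaces unfolding L .
  have "\<exists>B. independent B \<and> span B = UNIV \<and> M = int_span sW B"
    by (rule integral_form(1)[OF fd M M_modes M_least])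
  moreover have "M = add_subgroup hull (\<Union>a. weight_space sW (code_mode {}) a \<inter> M)"
    by (rule integral_form(2)[OF fd M M_modes M_least])
  ultimately have "module_integral_form sW YW omegaT A M"
    unfolding module_integral_form_def L using MA by blast
  then show ?thesis by (simp add: M_def A_def)
qed

end
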